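(* Let $p$ be a prime and let $K = \mathbb{Q}_p$ be the $p$-adic completion of $\mathbb{Q}$, and suppose that $-1$ is not a square in $K$. Let $p + 1 = 2^a l$ with $l$ odd and $a \geq 1$, and let $n = 2^{\alpha} k$ with $k$ odd and $2 \leq \alpha \leq a+1$. Then there exists a cyclic Galois extension $L$ of $K$ of degree $n$, with Galois group $\langle \sigma \rangle$, and $K$-subspaces of $A^1 = A^{\sigma}$ such that $$A^1 = \mathcal{V}_1 \oplus \mathcal{V}_2 \oplus \mathcal{E}_1 \oplus \cdots \oplus \mathcal{E}_{\alpha - 1},$$ where (i) $\mathcal{E}_i$ is an $n$-subspace of dimension $n/2^i$ for $1 \leq i \leq \alpha - 1$; (ii) $\mathcal{V}_j$ is an $(n-2)$-subspace of dimension $k$ for $1 \leq j \leq 2$.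
   Context: For a finite Galois extension $L/K$, $\mathrm{Alt}_K(L)$ denotes the $K$-space of alternating $K$-bilinear forms (skew-forms) $L \times L \to K$, and $\mathrm{Tr}^L_K(a) = \sum_{\theta \in \mathrm{Gal}(L/K)} \theta(a)$. For $\tau \in \mathrm{Gal}(L/K)$ and $b \in L$ define the skew-form $f_{b,\tau}(x,y) = \mathrm{Tr}^L_K\big(b(x\tau(y) - \tau(x)y)\big)$ for $x,y \in L$, and the subspace $A^{\tau} = \{ f_{b,\tau} : b \in L\}$ of $\mathrm{Alt}_K(L)$. If $\mathrm{Gal}(L/K) = \langle \sigma\rangle$ is cyclic, write $A^i = A^{\sigma^i}$. An $r$-subspace of $\mathrm{Alt}_K(L)$ is a $K$-subspace all of whose nonzero skew-forms have rank $r$. Dimensions are over $K$. *)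

theory Defs
  imports
    "HOL-Analysis.Abstract_Metric_Spaces"
    "HOL-Algebra.Algebraic_Closure_Type"
    "HOL-Algebra.Bij"
    "HOL-Algebra.Generated_Groups"
    "HOL-Library.Function_Algebras"
begin

definition padic_abs :: "nat \<Rightarrow> rat \<Rightarrow> real" where
  "padic_abs p q =
     (if q = 0 then 0
      else case quotient_of q of (r, s) \<Rightarrow>
        real p powi (int (multiplicity (int p) s) - int (multiplicity (int p) r)))"

(* The field 'k with absolute value v is a completion of the rationals with respect to the
   p-adic absolute value.  This determines ('k, v) up to a unique isometric isomorphism. *)
definition padic_completion :: "nat \<Rightarrow> ('k :: field_char_0 \<Rightarrow> real) \<Rightarrow> bool" where
  "padic_completion p v \<longleftrightarrow>
     (\<forall>x. 0 \<le> v x) \<and> (\<forall>x. v x = 0 \<longleftrightarrow> x = 0) \<and>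
     (\<forall>x y. v (x * y) = v x * v y) \<and> (\<forall>x y. v (x + y) \<le> v x + v y) \<and>
     (\<forall>q. v (of_rat q) = padic_abs p q) \<and>
     Metric_space.mcomplete UNIV (\<lambda>x y. v (x - y)) \<and>
     Metric_space.mtopology UNIV (\<lambda>x y. v (x - y)) closure_of \<rat> = UNIV"

(* Algebraic extensions of 'k are the subfields of 'k alg_closure containing the image of 'k
   under to_ac; the partial inverse of to_ac is of_ac. *)

global_interpretation ac: vector_space "\<lambda>(c :: 'k :: field) (x :: 'k alg_closure). to_ac c * x"
  by unfold_locales (simp_all add: algebra_simps)

(* The elements of the carrier are undefined outside L, as required by BijGroup, so that
   distinct elements are distinct automorphisms of L. *)
definition gal_group :: "'k :: field alg_closure set \<Rightarrow> ('k alg_closure \<Rightarrow> 'k alg_closure) monoid" where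
  "gal_group L = BijGroup L \<lparr>carrier :=
     {\<theta> \<in> Bij L. (\<forall>x\<in>L. \<forall>y\<in>L. \<theta> (x + y) = \<theta> x + \<theta> y \<and> \<theta> (x * y) = \<theta> x * \<theta> y) \<and>
                 (\<forall>c. \<theta> (to_ac c) = to_ac c)}\<rparr>"

definition finite_galois_extension :: "'k :: field alg_closure set \<Rightarrow> bool" where
  "finite_galois_extension L \<longleftrightarrow>
     subfield L ring_of_type_algebra \<and> range to_ac \<subseteq> L \<and>
     (\<exists>B. finite B \<and> ac.span B = L) \<and>
     {x \<in> L. \<forall>\<theta> \<in> carrier (gal_group L). \<theta> x = x} = range to_ac"

definition gal_trace :: "'k :: field alg_closure set \<Rightarrow> 'k alg_closure \<Rightarrow> 'k" where
  "gal_trace L x = of_ac (\<Sum>\<theta> \<in> carrier (gal_group L). \<theta> x)"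

(* A form on L is a function on all of 'k alg_closure vanishing outside L \<times> L. *)

type_synonym 'k form = "'k alg_closure \<Rightarrow> 'k alg_closure \<Rightarrow> 'k"

definition alt_forms :: "'k :: field alg_closure set \<Rightarrow> 'k form set" where
  "alt_forms L = {f.
     (\<forall>x y. x \<notin> L \<or> y \<notin> L \<longrightarrow> f x y = 0) \<and>
     (\<forall>x\<in>L. \<forall>y\<in>L. \<forall>z\<in>L. f (x + y) z = f x z + f y z \<and> f z (x + y) = f z x + f z y) \<and>
     (\<forall>c. \<forall>x\<in>L. \<forall>y\<in>L. f (to_ac c * x) y = c * f x y \<and> f x (to_ac c * y) = c * f x y) \<and>
     (\<forall>x\<in>L. f x x = 0)}"

definition form_scale :: "'k :: field \<Rightarrow> 'k form \<Rightarrow> 'k form" where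
  "form_scale c f = (\<lambda>x y. c * f x y)"

global_interpretation form: vector_space "form_scale :: 'k :: field \<Rightarrow> 'k form \<Rightarrow> 'k form"
  by unfold_locales (simp_all add: form_scale_def fun_eq_iff algebra_simps)

definition form_radical :: "'k :: field alg_closure set \<Rightarrow> 'k form \<Rightarrow> 'k alg_closure set" where
  "form_radical L f = {x \<in> L. \<forall>y\<in>L. f x y = 0}"

definition form_rank :: "'k :: field alg_closure set \<Rightarrow> 'k form \<Rightarrow> nat" where
  "form_rank L f = ac.dim L - ac.dim (form_radical L f)"

definition rank_subspace :: "'k :: field alg_closure set \<Rightarrow> nat \<Rightarrow> 'k form set \<Rightarrow> bool" where
  "rank_subspace L r W \<longleftrightarrow>
     form.subspace W \<and> W \<subseteq> alt_forms L \<and> (\<forall>f\<in>W. f \<noteq> 0 \<longrightarrow> form_rank L f = r)"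

definition skew_form ::
  "'k :: field alg_closure set \<Rightarrow> ('k alg_closure \<Rightarrow> 'k alg_closure) \<Rightarrow> 'k alg_closure \<Rightarrow> 'k form" where
  "skew_form L \<tau> b =
     (\<lambda>x y. if x \<in> L \<and> y \<in> L then gal_trace L (b * (x * \<tau> y - \<tau> x * y)) else 0)"

definition skew_space ::
  "'k :: field alg_closure set \<Rightarrow> ('k alg_closure \<Rightarrow> 'k alg_closure) \<Rightarrow> 'k form set" where
  "skew_space L \<tau> = skew_form L \<tau> ` L"

(* A is the internal direct sum of the family W indexed by I: every element of A has a unique
   expression as a sum of members of the W i, and all these sums lie in A. *)
definition is_direct_sum :: "'a :: comm_monoid_add set \<Rightarrow> 'i set \<Rightarrow> ('i \<Rightarrow> 'a set) \<Rightarrow> bool" where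
  "is_direct_sum A I W \<longleftrightarrow> bij_betw (\<lambda>w. \<Sum>i\<in>I. w i) (PiE I W) A"

end

theory Submission
  imports Defs "HOL-Number_Theory.Residues"
begin

text \<open>The form attached to \<open>b\<close> is studied through its radical. As the trace is invariant under
  \<open>\<sigma>\<close> and the trace form is nondegenerate, the radical consists of the \<open>x\<close> in \<open>L\<close> with
  \<open>b x = \<sigma>(b) \<sigma>\<^sup>2(x)\<close> (lemma \<open>radical\<close>). For \<open>b \<noteq> 0\<close> it is therefore either zero or a line over
  the fixed field of \<open>\<sigma>\<^sup>2\<close>, which is quadratic over \<open>K\<close>, and the rank is \<open>n\<close> or \<open>n - 2\<close>. The form
  determines \<open>b\<close>, so the theorem amounts to a decomposition of \<open>L\<close> itself into subspaces on which
  this equation is never, respectively always, solvable with \<open>x \<noteq> 0\<close>.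

  For \<open>L\<close> one takes the unramified extension of degree \<open>n\<close>, generated by a primitive
  \<open>(p^n - 1)\<close>-th root of unity \<open>\<omega>\<close>, and for \<open>\<sigma>\<close> the Frobenius automorphism \<open>\<omega> \<mapsto> \<omega>^p\<close>. That
  \<open>\<omega>\<close> and \<open>\<omega>^p\<close> are conjugate follows from the separability of \<open>X^(p^n - 1) - 1\<close> modulo \<open>p\<close>
  (\<open>ev_g_frobenius\<close>). That nothing outside \<open>K\<close> is fixed by \<open>\<sigma>\<close> is where completeness enters: an
  integral fixed element is congruent to its \<open>p\<close>-th power, so it has a Teichmueller lift, which
  must be congruent to an integer, and successive approximation shows that the element lies in \<open>K\<close>
  (\<open>fixed_field\<close>). The general theory of the extension then only uses that \<open>\<omega>\<close> is a primitive
  element with \<open>n\<close> conjugates.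

  If \<open>-1\<close> is not a square, then \<open>p\<close> is congruent to \<open>3\<close> modulo \<open>4\<close>, that is \<open>a \<ge> 2\<close>, since
  otherwise \<open>\<sigma>\<close> would fix the fourth roots of unity. The exact power of \<open>2\<close> dividing \<open>p^n - 1\<close> is
  then \<open>2^(a + \<alpha>)\<close>. Let \<open>\<zeta>\<close> be a root of unity of that order, let \<open>\<iota>\<close> be a fourth root of unity,
  and let \<open>M\<^sub>j\<close> be the fixed field of \<open>\<sigma>^(n/2^j)\<close>. This power of \<open>\<sigma>\<close> is an involution of
  \<open>M\<^sub>j\<^sub>-\<^sub>1\<close> that negates \<open>\<zeta>^(2^(j-1))\<close> for \<open>j < \<alpha>\<close> and negates \<open>\<iota>\<close> for \<open>j = \<alpha>\<close>, so \<open>M\<^sub>j\<^sub>-\<^sub>1\<close> splits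
  into two eigenspaces (\<open>Fix_double\<close>). Iterating from \<open>M\<^sub>0 = L\<close> yields the summands
  \<open>E\<^sub>j = \<zeta>^(2^(j-1)) M\<^sub>j\<close> for \<open>j < \<alpha>\<close>, of dimension \<open>n/2^j\<close>, together with \<open>V\<^sub>1 = M\<^sub>\<alpha>\<close> and
  \<open>V\<^sub>2 = \<iota> M\<^sub>\<alpha>\<close>, of dimension \<open>k\<close>.

  On \<open>V\<^sub>1\<close> and \<open>V\<^sub>2\<close> the radical equation has an explicit solution because \<open>k\<close> is odd
  (\<open>V_degenerate\<close>). On \<open>E\<^sub>j\<close> it has none (\<open>E_nondegenerate\<close>): taking norms to the fixed field of
  \<open>\<sigma>\<^sup>2\<close>, a solution would produce a root of unity \<open>w\<close> of order dividing \<open>2^j\<close> with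
  \<open>w \<sigma>(w) = -1\<close>, whereas \<open>w \<sigma>(w) = w^(p + 1) = 1\<close> because \<open>j \<le> \<alpha> - 1 \<le> a\<close>.\<close>

section \<open>The p-adic absolute value\<close>

locale padic =
  fixes p :: nat and v :: "'k :: field_char_0 \<Rightarrow> real"
  assumes prime_p: "prime p" and completion: "padic_completion p v"
begin

lemma p_gt_1: "p > 1"
  using prime_gt_1_nat[OF prime_p] by simp

lemma v_nonneg [simp]: "0 \<le> v x"
  and v_eq_0_iff [simp]: "v x = 0 \<longleftrightarrow> x = 0"
  and v_mult [simp]: "v (x * y) = v x * v y"
  and v_triangle: "v (x + y) \<le> v x + v y"
  and v_of_rat: "v (of_rat q) = padic_abs p q"
  using completion unfolding padic_completion_def by auto

lemma v_0 [simp]: "v 0 = 0" by simp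

lemma v_1 [simp]: "v 1 = 1"
proof -
  have "v 1 * v 1 = v 1 * 1" using v_mult[of 1 1] by simp
  moreover have "v 1 \<noteq> 0" by simp
  ultimately show ?thesis using mult_left_cancel by blast
qed

lemma v_power [simp]: "v (x ^ m) = v x ^ m"
  by (induction m) auto

lemma v_minus [simp]: "v (- x) = v x"
proof -
  have "v (- 1) ^ 2 = 1" using v_power[of "-1" 2] by simp
  then have "v (- 1) = 1" using v_nonneg[of "-1"] by (auto simp: power2_eq_1_iff)
  then show ?thesis using v_mult[of "-1" x] by simp
qed

lemma v_diff_commute: "v (x - y) = v (y - x)"
  using v_minus[of "x - y"] by simp

lemma v_of_int:
  assumes "m \<noteq> 0"
  shows "v (of_int m) = (1 / real p) ^ multiplicity (int p) m"
proof -
  have "v (of_int m) = padic_abs p (of_int m)"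
    using v_of_rat[of "of_int m"] by simp
  also have "\<dots> = real p powi (- int (multiplicity (int p) m))"
    using assms by (simp add: padic_abs_def)
  finally show ?thesis
    by (simp add: power_int_minus power_divide inverse_eq_divide)
qed

lemma v_of_int_le_1: "v (of_int m) \<le> 1"
  using p_gt_1 by (cases "m = 0") (auto simp: v_of_int power_le_one)

lemma v_of_nat_le_1: "v (of_nat m) \<le> 1"
  using v_of_int_le_1[of "int m"] by simp

lemma v_p: "v (of_nat p) = 1 / real p"
  using v_of_int[of "int p"] p_gt_1 by (simp add: multiplicity_self)

lemma v_of_int_eq_1: "\<not> int p dvd m \<Longrightarrow> v (of_int m) = 1"
  using v_of_int[of m] by (cases "m = 0") (auto simp: not_dvd_imp_multiplicity_0)

text \<open>Every integer has absolute value at most 1, so the binomial theorem gives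
  \<open>v (x + y) ^ m \<le> (m + 1) * max (v x) (v y) ^ m\<close>; comparing growth in \<open>m\<close> removes the
  factor \<open>m + 1\<close>.\<close>

lemma v_add_le_max: "v (x + y) \<le> max (v x) (v y)"
proof (rule ccontr)
  define M where "M = max (v x) (v y)"
  assume "\<not> v (x + y) \<le> max (v x) (v y)"
  then have less: "M < v (x + y)" unfolding M_def by linarith
  have M0: "0 \<le> M" unfolding M_def using v_nonneg[of x] by linarith
  have v_sum: "v (sum f A) \<le> (\<Sum>a\<in>A. v (f a))" if "finite A" for f and A :: "nat set"
    using that by (induction A) (auto intro: order_trans[OF v_triangle])
  have pow: "v (x + y) ^ m \<le> real (Suc m) * M ^ m" for m
  proof -
    have "v (x + y) ^ m = v ((x + y) ^ m)" by simp
    also have "\<dots> = v (\<Sum>i\<le>m. of_nat (m choose i) * x ^ i * y ^ (m - i))"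
      by (simp add: binomial_ring)
    also have "\<dots> \<le> (\<Sum>i\<le>m. v (of_nat (m choose i) * x ^ i * y ^ (m - i)))"
      by (rule v_sum) simp
    also have "\<dots> \<le> (\<Sum>i\<le>m. M ^ m)"
    proof (rule sum_mono)
      fix i assume i: "i \<in> {..m}"
      have "v (of_nat (m choose i) * x ^ i * y ^ (m - i)) \<le> 1 * M ^ i * M ^ (m - i)"
        unfolding v_mult v_power
        by (intro mult_mono power_mono v_of_nat_le_1) (auto simp: M_def M0[unfolded M_def])
      also have "\<dots> = M ^ m" using i by (simp flip: power_add)
      finally show "v (of_nat (m choose i) * x ^ i * y ^ (m - i)) \<le> M ^ m" .
    qed
    finally show ?thesis by simp
  qed
  show False
  proof (cases "M = 0")
    case True
    then show False using pow[of 1] less by simp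
  next
    case False
    then have Mpos: "M > 0" using M0 by simp
    define r where "r = v (x + y) / M - 1"
    have r: "r > 0" using less Mpos by (simp add: r_def)
    \<comment> \<open>beyond this \<open>m\<close> the quadratic lower bound exceeds the linear upper bound\<close>
    obtain m :: nat where m: "real m * r\<^sup>2 > 4"  and m2: "m \<ge> 2"
    proof -
      obtain m0 :: nat where "4 / r\<^sup>2 < real m0" using reals_Archimedean2 by blast
      then have "real m0 * r\<^sup>2 > 4" using r by (simp add: field_simps)
      then have "real (max m0 2) * r\<^sup>2 > 4"
        using r by (smt (verit, best) max.cobounded1 mult_right_mono of_nat_le_iff zero_le_power2)
      then show ?thesis using that[of "max m0 2"] by simp
    qed
    \<comment> \<open>Bernoulli only gives linear growth; squaring it makes it quadratic in \<open>m\<close>\<close>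
    have "(1 + real m * r) \<le> (1 + r) ^ m"
      using Bernoulli_inequality[of r m] r by simp
    then have "(1 + real m * r) ^ 2 \<le> ((1 + r) ^ m) ^ 2"
      using r by (intro power_mono) auto
    also have "\<dots> = (1 + r) ^ (2 * m)" by (simp flip: power_mult add: mult.commute)
    also have "\<dots> = v (x + y) ^ (2 * m) / M ^ (2 * m)"
      by (simp add: r_def power_divide)
    also have "\<dots> \<le> real (Suc (2 * m))"
      using pow[of "2 * m"] Mpos by (simp add: field_simps)
    finally have "(1 + real m * r) ^ 2 \<le> real (Suc (2 * m))" .
    moreover have "(1 + real m * r) ^ 2 \<ge> real m * (real m * r\<^sup>2)"
      using r by (simp add: power2_eq_square algebra_simps)
    moreover have "real m * (real m * r\<^sup>2) > real m * 4"
      using m m2 by (intro mult_strict_left_mono) auto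
    ultimately show False using m2 by simp
  qed
qed

lemma v_add_le: "v x \<le> c \<Longrightarrow> v y \<le> c \<Longrightarrow> v (x + y) \<le> c"
  using v_add_le_max[of x y] by simp

lemma v_diff_le: "v x \<le> c \<Longrightarrow> v y \<le> c \<Longrightarrow> v (x - y) \<le> c"
  using v_add_le[of x c "- y"] by simp

lemma v_sum_le: "(\<And>a. a \<in> A \<Longrightarrow> v (f a) \<le> c) \<Longrightarrow> 0 \<le> c \<Longrightarrow> v (sum f A) \<le> c"
  by (induction A rule: infinite_finite_induct) (auto intro: v_add_le)

lemma v_sum_less: "(\<And>a. a \<in> A \<Longrightarrow> v (f a) < c) \<Longrightarrow> 0 < c \<Longrightarrow> v (sum f A) < c"
proof (induction A rule: infinite_finite_induct)
  case (insert a A)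
  then show ?case using v_add_le_max[of "f a" "sum f A"] by force
qed auto

lemma v_eqI: "v (x - y) < v x \<Longrightarrow> v x = v y"
  using v_add_le_max[of "x - y" y] v_add_le_max[of "y - x" x] v_diff_commute[of x y] by (auto simp: max_def split: if_splits)

lemma metric: "Metric_space UNIV (\<lambda>x y. v (x - y))"
proof
  fix x y z :: 'k
  show "v (x - z) \<le> v (x - y) + v (y - z)"
    using v_triangle[of "x - y" "y - z"] by simp
qed (auto simp: v_diff_commute)

sublocale metric: Metric_space UNIV "\<lambda>x y. v (x - y)"
  by (rule metric)

lemma rat_dense:
  assumes "e > 0"
  obtains q where "v (x - of_rat q) < e"
proof -
  have "x \<in> metric.mtopology closure_of \<rat>"
    using completion unfolding padic_completion_def by auto
  then have "\<exists>y\<in>\<rat>. y \<in> metric.mball x e"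
    using assms unfolding metric.metric_closure_of by blast
  then show ?thesis using that by (auto simp: Rats_def metric.in_mball)
qed

lemma v_of_rat_powi:
  assumes "q \<noteq> 0"
  obtains m :: int where "v (of_rat q) = real p powi m"
proof -
  obtain r s where "quotient_of q = (r, s)" by fastforce
  then show ?thesis using that assms unfolding v_of_rat padic_abs_def by auto
qed

text \<open>The value group is generated by \<open>1 / p\<close>, because the rationals are dense.\<close>

lemma v_powi:
  assumes "x \<noteq> 0"
  obtains m :: int where "v x = real p powi m"
proof -
  obtain q where q: "v (x - of_rat q) < v x"
    using rat_dense[of "v x" x] assms v_nonneg[of x] v_eq_0_iff[of x] by (metis less_eq_real_def)
  then have "v x = v (of_rat q)" by (rule v_eqI)
  moreover from this have "q \<noteq> 0" using assms by auto
  ultimately show ?thesis using v_of_rat_powi that by metis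
qed

lemma v_discrete:
  assumes "v x < 1"
  shows "v x \<le> 1 / real p"
proof (cases "x = 0")
  case False
  then obtain m where m: "v x = real p powi m" by (rule v_powi)
  have "m < 0"
  proof (rule ccontr)
    assume "\<not> m < 0"
    then have "real p powi m \<ge> real p powi 0"
      using p_gt_1 by (intro power_int_increasing) auto
    then show False using assms m by simp
  qed
  then have "real p powi m \<le> real p powi (- 1)"
    using p_gt_1 by (intro power_int_increasing) auto
  then show ?thesis using m by (simp add: power_int_minus inverse_eq_divide)
qed simp

lemma int_power_p_cong: "int p dvd m ^ p - m" for m :: int
proof (cases "int p dvd m")
  case True
  moreover from this have "int p dvd m ^ p" using p_gt_1 by (simp add: dvd_trans[OF _ dvd_power])
  ultimately show ?thesis by simp
next
  case False
  have "[m ^ (p - 1) = 1] (mod int p)"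
  proof -
    define m' where "m' = nat (m mod int p)"
    have m': "int m' = m mod int p" using p_gt_1 by (simp add: m'_def)
    then have "\<not> p dvd m'" using False by (metis dvd_mod_iff int_dvd_int_iff dvd_refl)
    then have "[m' ^ (p - 1) = 1] (mod p)" by (rule fermat_theorem[OF prime_p])
    then have "[int m' ^ (p - 1) = 1] (mod int p)"
      by (metis cong_int_iff of_nat_1 of_nat_power)
    moreover have "[m ^ (p - 1) = int m' ^ (p - 1)] (mod int p)"
      unfolding m' by (intro cong_pow) (simp add: cong_def)
    ultimately show ?thesis by (rule cong_trans[rotated])
  qed
  then have "[m ^ (p - 1) * m = 1 * m] (mod int p)" by (rule cong_scalar_right)
  moreover have "m ^ (p - 1) * m = m ^ p" using p_gt_1 by (simp flip: power_Suc2)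
  ultimately show ?thesis by (simp add: cong_iff_dvd_diff)
qed

text \<open>The residue field is the prime field. By density it suffices to consider fractions \<open>r / s\<close>
  with \<open>s\<close> prime to \<open>p\<close>, where the claim is Fermat's little theorem.\<close>

lemma residue_frobenius:
  assumes "v x \<le> 1"
  shows "v (x ^ p - x) \<le> 1 / real p"
proof -
  obtain q where q: "v (x - of_rat q) < 1" using rat_dense[of 1 x] by auto
  define y :: 'k where "y = of_rat q"
  have vy: "v y \<le> 1"
    using v_diff_le[of x 1 "x - y"] q assms by (simp add: y_def)
  obtain r s where rs: "quotient_of q = (r, s)" by fastforce
  then have s0: "s > 0" and cop: "coprime r s" and q_eq: "q = of_int r / of_int s"
    using quotient_of_denom_pos quotient_of_coprime quotient_of_div by blast+
  have y_eq: "y = of_int r / of_int s" by (simp add: y_def q_eq of_rat_divide)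
  have ys: "y * of_int s = of_int r" using s0 by (simp add: y_eq)
  have p_s: "\<not> int p dvd s"
  proof
    assume ps: "int p dvd s"
    then have "\<not> int p dvd r"
      using cop p_gt_1 coprime_common_divisor[of r s "int p"] by auto
    then have "v y * v (of_int s) = 1"
      using ys v_mult[of y "of_int s"] by (simp add: v_of_int_eq_1)
    moreover have "v (of_int s) < 1"
    proof -
      obtain t where "s = int p * t" using ps by blast
      then have "v (of_int s) = v (of_nat p) * v (of_int t)" by simp
      also have "\<dots> \<le> 1 / real p * 1"
        using v_of_int_le_1 by (intro mult_mono) (auto simp: v_p)
      also have "\<dots> < 1" using p_gt_1 by simp
      finally show ?thesis .
    qed
    ultimately show False
      using vy by (smt (verit) mult_left_le_one_le v_nonneg)
  qed
  have "int p dvd r ^ p * s - r * s ^ p"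
  proof -
    have "r ^ p * s - r * s ^ p = (r ^ p - r) * s - r * (s ^ p - s)" by (simp add: algebra_simps)
    then show ?thesis using int_power_p_cong by (metis dvd_diff dvd_mult dvd_mult2)
  qed
  then obtain t where t: "r ^ p * s - r * s ^ p = int p * t" by blast
  have "(y ^ p - y) * of_int s ^ (p + 1) = of_int (r ^ p * s - r * s ^ p)"
    by (simp add: ys[symmetric] algebra_simps)
  then have "v (y ^ p - y) * v (of_int s ^ (p + 1)) = v (of_int (int p * t))"
    unfolding t by (metis v_mult)
  then have "v (y ^ p - y) = v (of_nat p) * v (of_int t)"
    using p_s by (simp add: v_of_int_eq_1)
  also have "\<dots> \<le> 1 / real p * 1"
    using v_of_int_le_1 by (intro mult_mono) (auto simp: v_p)
  finally have yy: "v (y ^ p - y) \<le> 1 / real p" by simp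
  have xy: "v (x - y) \<le> 1 / real p" using q v_discrete by (simp add: y_def)
  have "x ^ p - y ^ p = (x - y) * (\<Sum>i<p. y ^ (p - Suc i) * x ^ i)"
    by (rule power_diff_sumr2)
  then have "v (x ^ p - y ^ p) = v (x - y) * v (\<Sum>i<p. y ^ (p - Suc i) * x ^ i)" by simp
  also have "\<dots> \<le> 1 / real p * 1"
    using xy assms vy
    by (intro mult_mono v_sum_le) (auto intro!: mult_le_one power_le_one)
  finally have "v (x ^ p - y ^ p) \<le> 1 / real p" by simp
  then have "v ((x ^ p - y ^ p) + (y ^ p - y)) \<le> 1 / real p"
    using yy by (rule v_add_le)
  then have "v ((x ^ p - y ^ p) + (y ^ p - y) - (x - y)) \<le> 1 / real p"
    using xy by (rule v_diff_le)
  then show ?thesis by simp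
qed

text \<open>The partial sums form a Cauchy sequence, and the ultrametric inequality bounds every tail, hence
  also its limit, by the bound on its first term.\<close>

lemma series_limit:
  assumes c: "\<And>m. v (c m) \<le> (1 / real p) ^ m"
  obtains s where "\<And>m. v (s - (\<Sum>i<m. c i)) \<le> (1 / real p) ^ m"
proof -
  define S where "S m = (\<Sum>i<m. c i)" for m
  have tail: "v (S m' - S m) \<le> (1 / real p) ^ m" if "m \<le> m'" for m m'
  proof -
    have "S m' - S m = (\<Sum>i\<in>{m..<m'}. c i)"
      using that by (simp add: S_def sum_diff_nat_ivl lessThan_atLeast0)
    also have "v \<dots> \<le> (1 / real p) ^ m"
      using p_gt_1 by (intro v_sum_le order_trans[OF c] power_decreasing) auto
    finally show ?thesis .
  qed
  have small: "\<exists>N. (1 / real p) ^ N < e" if "e > 0" for e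
    using p_gt_1 that by (intro real_arch_pow_inv) auto
  have "metric.MCauchy S"
    unfolding metric.MCauchy_def
  proof (intro conjI allI impI)
    fix e :: real assume "e > 0"
    then obtain N where N: "(1 / real p) ^ N < e" using small by blast
    show "\<exists>N. \<forall>n n'. N \<le> n \<longrightarrow> N \<le> n' \<longrightarrow> v (S n - S n') < e"
    proof (intro exI allI impI)
      fix n n' assume "N \<le> n" "N \<le> n'"
      then have "v ((S n - S N) - (S n' - S N)) \<le> (1 / real p) ^ N"
        by (intro v_diff_le tail)
      then show "v (S n - S n') < e" using N by simp
    qed
  qed auto
  moreover have "metric.mcomplete"
    using completion unfolding padic_completion_def by blast
  ultimately obtain s where s: "limitin metric.mtopology S s sequentially"
    unfolding metric.mcomplete_def by blast
  have "v (s - S m) \<le> (1 / real p) ^ m" for m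
  proof -
    have "(1 / real p) ^ m > 0" using p_gt_1 by simp
    then have "\<forall>\<^sub>F i in sequentially. v (S i - s) < (1 / real p) ^ m"
      using s unfolding metric.limitin_metric by (auto simp: eventually_conj_iff)
    then obtain N where N: "\<And>i. i \<ge> N \<Longrightarrow> v (S i - s) < (1 / real p) ^ m"
      by (auto simp: eventually_sequentially)
    have "v ((S (max N m) - S m) - (S (max N m) - s)) \<le> (1 / real p) ^ m"
      using less_imp_le[OF N[of "max N m"]] by (intro v_diff_le[OF tail]) auto
    then show ?thesis by simp
  qed
  then show ?thesis using that by (auto simp: S_def)
qed

end

section \<open>Polynomials over the p-adic integers\<close>

definition ev :: "'k :: field poly \<Rightarrow> 'k alg_closure \<Rightarrow> 'k alg_closure" where
  "ev q y = poly (map_poly to_ac q) y"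

lemma ev_0 [simp]: "ev 0 y = 0"
  and ev_1 [simp]: "ev 1 y = 1"
  and ev_pCons [simp]: "ev (pCons a q) y = to_ac a + y * ev q y"
  and ev_smult [simp]: "ev (smult a q) y = to_ac a * ev q y"
  and ev_monom [simp]: "ev (monom a m) y = to_ac a * y ^ m"
  by (simp_all add: ev_def map_poly_pCons map_poly_smult map_poly_monom poly_monom)

lemma ev_add [simp]: "ev (q + r) y = ev q y + ev r y"
  and ev_diff [simp]: "ev (q - r) y = ev q y - ev r y"
proof -
  have "map_poly to_ac (q + r) = map_poly to_ac q + map_poly to_ac r"
       "map_poly to_ac (q - r) = map_poly to_ac q - map_poly to_ac r"
    by (auto intro!: poly_eqI simp: coeff_map_poly)
  then show "ev (q + r) y = ev q y + ev r y" "ev (q - r) y = ev q y - ev r y"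
    by (simp_all add: ev_def)
qed

lemma ev_minus [simp]: "ev (- q) y = - ev q y"
  using ev_diff[of 0 q y] by simp

lemma ev_mult [simp]: "ev (q * r) y = ev q y * ev r y"
  by (induction q) (simp_all add: mult_pCons_left algebra_simps)

lemma ev_sum: "ev (\<Sum>i\<in>A. f i) y = (\<Sum>i\<in>A. ev (f i) y)"
  by (induction A rule: infinite_finite_induct) auto

lemma ev_of_nat [simp]: "ev (of_nat m) y = of_nat m"
  by (induction m) auto

lemma ev_root_finite:
  fixes q :: "'k :: field poly"
  assumes "q \<noteq> 0"
  shows "finite {y. ev q y = 0}" "card {y. ev q y = 0} \<le> degree q"
proof -
  have "map_poly to_ac q \<noteq> 0" using assms by (simp add: map_poly_eq_0_iff)
  then show "finite {y. ev q y = 0}" "card {y. ev q y = 0} \<le> degree q"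
    using poly_roots_finite[of "map_poly to_ac q"] card_poly_roots_bound[of "map_poly to_ac q"]
    by (simp_all add: ev_def degree_map_poly)
qed

context padic
begin

text \<open>All coefficients are integral and divisible by \<open>p ^ k\<close>.\<close>

definition ipoly :: "nat \<Rightarrow> 'k poly \<Rightarrow> bool" where
  "ipoly k q \<longleftrightarrow> (\<forall>i. v (coeff q i) \<le> (1 / real p) ^ k)"

lemma ipolyD: "ipoly k q \<Longrightarrow> v (coeff q i) \<le> (1 / real p) ^ k"
  by (simp add: ipoly_def)

lemma ipoly_0 [simp]: "ipoly k 0" by (simp add: ipoly_def)

lemma ipoly_1 [simp]: "ipoly 0 1" by (simp add: ipoly_def)

lemma ipoly_add: "ipoly k q \<Longrightarrow> ipoly k r \<Longrightarrow> ipoly k (q + r)"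
  and ipoly_diff: "ipoly k q \<Longrightarrow> ipoly k r \<Longrightarrow> ipoly k (q - r)"
  by (auto simp: ipoly_def intro: v_add_le v_diff_le)

lemma ipoly_mult:
  assumes "ipoly j q" "ipoly k r"
  shows "ipoly (j + k) (q * r)"
  unfolding ipoly_def coeff_mult power_add
  using assms p_gt_1 by (intro allI v_sum_le) (auto simp: ipoly_def intro!: mult_mono)

lemma ipoly_mono: "ipoly k q \<Longrightarrow> j \<le> k \<Longrightarrow> ipoly j q"
  using p_gt_1 power_decreasing[of j k "1 / real p"] unfolding ipoly_def
  by (force intro: order_trans)

lemma ipoly_monom: "ipoly k (monom c m) \<longleftrightarrow> v c \<le> (1 / real p) ^ k"
  by (auto simp: ipoly_def)

lemma ipoly_pCons: "ipoly k (pCons c q) \<longleftrightarrow> v c \<le> (1 / real p) ^ k \<and> ipoly k q"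
  by (auto simp: ipoly_def coeff_pCons split: nat.splits)

text \<open>Gauss's lemma. Among the coefficients of largest absolute value, take the first one of
  either factor: their product dominates the corresponding coefficient of the product.\<close>

lemma monic_factor_integral:
  assumes f: "lead_coeff f = 1" and h: "lead_coeff h = 1" and fh: "ipoly 0 (f * h)"
  shows "ipoly 0 f"
proof -
  have peak: "\<exists>i. v (coeff q i) \<ge> 1 \<and> (\<forall>j. v (coeff q j) \<le> v (coeff q i)) \<and>
                 (\<forall>j<i. v (coeff q j) < v (coeff q i))"
    if q: "lead_coeff q = 1" for q
  proof -
    define M where "M = Max ((\<lambda>i. v (coeff q i)) ` {..degree q})"
    have "M \<in> (\<lambda>i. v (coeff q i)) ` {..degree q}" unfolding M_def by (intro Max_in) auto
    then have ex: "\<exists>i. v (coeff q i) = M" by auto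
    have le_deg: "v (coeff q j) \<le> M" if "j \<le> degree q" for j
      using that unfolding M_def by (intro Max_ge) auto
    have "1 \<le> M" using le_deg[of "degree q"] q by simp
    then have le: "v (coeff q j) \<le> M" for j
      using le_deg[of j] by (cases "j \<le> degree q") (auto simp: coeff_eq_0)
    define i where "i = (LEAST i. v (coeff q i) = M)"
    have "v (coeff q i) = M" unfolding i_def using ex by (rule LeastI_ex)
    moreover have "v (coeff q j) < M" if "j < i" for j
      using not_less_Least[of j] that le[of j] unfolding i_def by force
    ultimately show ?thesis using le \<open>1 \<le> M\<close> by metis
  qed
  obtain i where i: "v (coeff f i) \<ge> 1" "\<And>j. v (coeff f j) \<le> v (coeff f i)"
      "\<And>j. j < i \<Longrightarrow> v (coeff f j) < v (coeff f i)"
    using peak[OF f] by blast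
  obtain j where j: "v (coeff h j) \<ge> 1" "\<And>i. v (coeff h i) \<le> v (coeff h j)"
      "\<And>i. i < j \<Longrightarrow> v (coeff h i) < v (coeff h j)"
    using peak[OF h] by blast
  define A where "A = v (coeff f i)"
  define B where "B = v (coeff h j)"
  have AB: "A \<ge> 1" "B \<ge> 1" using i j by (simp_all add: A_def B_def)
  define R where "R = (\<Sum>m\<in>{..i + j} - {i}. coeff f m * coeff h (i + j - m))"
  have "v R < A * B"
    unfolding R_def
  proof (rule v_sum_less)
    fix m assume m: "m \<in> {..i + j} - {i}"
    show "v (coeff f m * coeff h (i + j - m)) < A * B"
    proof (cases "m < i")
      case True
      have "v (coeff f m) * v (coeff h (i + j - m)) \<le> v (coeff f m) * B"
        using j(2) by (intro mult_left_mono) (auto simp: B_def)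
      also have "\<dots> < A * B"
        using i(3)[OF True] AB by (intro mult_strict_right_mono) (auto simp: A_def)
      finally show ?thesis by simp
    next
      case False
      then have "i + j - m < j" using m by auto
      have "v (coeff f m) * v (coeff h (i + j - m)) \<le> A * v (coeff h (i + j - m))"
        using i(2) by (intro mult_right_mono) (auto simp: A_def)
      also have "\<dots> < A * B"
        using j(3)[OF \<open>i + j - m < j\<close>] AB by (intro mult_strict_left_mono) (auto simp: B_def)
      finally show ?thesis by simp
    qed
  qed (use AB in auto)
  moreover have "coeff (f * h) (i + j) = coeff f i * coeff h j + R"
    unfolding coeff_mult R_def by (subst sum.remove[of _ i]) auto
  moreover have "v (coeff f i * coeff h j) = A * B" by (simp add: A_def B_def)
  ultimately have "v (coeff (f * h) (i + j)) = A * B"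
    using v_eqI[of "coeff f i * coeff h j" "coeff (f * h) (i + j)"] by (simp add: v_minus)
  then have "A * B \<le> 1" using ipolyD[OF fh, of "i + j"] by simp
  moreover have "A * 1 \<le> A * B" using AB by (intro mult_left_mono) auto
  ultimately have "A \<le> 1" by simp
  then show ?thesis using i(2) by (auto simp: ipoly_def A_def intro: order_trans)
qed

end

section \<open>The Frobenius automorphism of an unramified extension\<close>

locale unramified = padic p v for p and v :: "'k :: field_char_0 \<Rightarrow> real" +
  fixes n :: nat and \<omega> :: "'k alg_closure"
  assumes n_pos: "n > 0" and \<omega>: "\<And>j. \<omega> ^ j = 1 \<longleftrightarrow> p ^ n - 1 dvd j"
begin

definition N :: nat where "N = p ^ n - 1"

lemma N_pos: "N > 0"
  using p_gt_1 n_pos one_less_power[of p n] by (simp add: N_def)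

lemma \<omega>_power_eq_1_iff: "\<omega> ^ j = 1 \<longleftrightarrow> N dvd j"
  unfolding N_def by (rule \<omega>)

lemma \<omega>_power_N [simp]: "\<omega> ^ N = 1" by (simp only: \<omega>_power_eq_1_iff dvd_refl)

lemma \<omega>_nonzero [simp]: "\<omega> \<noteq> 0"
proof
  assume "\<omega> = 0"
  then have "\<omega> ^ N = 0" by (simp only: zero_power[OF N_pos])
  then show False by (simp only: \<omega>_power_N one_neq_zero)
qed

lemma minimal_polynomial_exists:
  "\<exists>g. lead_coeff g = 1 \<and> ev g \<omega> = 0 \<and> (\<forall>q. q \<noteq> 0 \<longrightarrow> ev q \<omega> = 0 \<longrightarrow> degree g \<le> degree q)"
proof -
  have "\<exists>q. q \<noteq> 0 \<and> ev q \<omega> = 0"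
  proof (intro exI conjI)
    have "coeff (monom 1 N - 1 :: 'k poly) N = 1" using N_pos by simp
    then show "(monom 1 N - 1 :: 'k poly) \<noteq> 0" by (metis coeff_0 zero_neq_one)
  qed simp
  then obtain q where q: "q \<noteq> 0" "ev q \<omega> = 0"
    and least: "\<And>r. r \<noteq> 0 \<Longrightarrow> ev r \<omega> = 0 \<Longrightarrow> degree q \<le> degree r"
    using ex_has_least_nat[of "\<lambda>q. q \<noteq> 0 \<and> ev q \<omega> = 0" _ degree] by blast
  then show ?thesis
    by (intro exI[of _ "smult (inverse (lead_coeff q)) q"]) auto
qed

definition g :: "'k poly" where
  "g = (SOME g. lead_coeff g = 1 \<and> ev g \<omega> = 0 \<and>
          (\<forall>q. q \<noteq> 0 \<longrightarrow> ev q \<omega> = 0 \<longrightarrow> degree g \<le> degree q))"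

lemma monic_g: "lead_coeff g = 1"
  and ev_g [simp]: "ev g \<omega> = 0"
  and g_minimal: "q \<noteq> 0 \<Longrightarrow> ev q \<omega> = 0 \<Longrightarrow> degree g \<le> degree q"
  using someI_ex[OF minimal_polynomial_exists] unfolding g_def[symmetric] by auto

lemma g_nonzero [simp]: "g \<noteq> 0" using monic_g by auto

lemma degree_g_pos: "degree g > 0"
proof (rule ccontr)
  assume "\<not> degree g > 0"
  then have "g = 1" using monic_g by (auto elim: degree_eq_zeroE)
  then show False using ev_g by simp
qed

lemma g_dvd_iff: "ev q \<omega> = 0 \<longleftrightarrow> g dvd q"
proof
  assume q: "ev q \<omega> = 0"
  have "ev (q div g * g + q mod g) \<omega> = 0" using q by simp
  then have "ev (q mod g) \<omega> = 0" by (simp only: ev_add ev_mult ev_g) simp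
  then have "q mod g = 0"
    using g_minimal[of "q mod g"] degree_mod_less[OF g_nonzero, of q] by (metis not_less)
  then show "g dvd q" by auto
qed auto

lemma factorization:
  obtains h where "monom 1 N - 1 = g * h" "ipoly 0 g" "ipoly 0 h"
proof -
  define U :: "'k poly" where "U = monom 1 N - 1"
  have "ev U \<omega> = 0" by (simp add: U_def)
  then obtain h where h: "U = g * h" using g_dvd_iff by blast
  have "degree U = N"
  proof (rule antisym)
    show "degree U \<le> N"
      unfolding U_def by (intro degree_diff_le) (auto simp: degree_monom_eq)
    have "coeff U N = 1" using N_pos by (simp add: U_def)
    then show "N \<le> degree U" by (intro le_degree) simp
  qed
  then have "lead_coeff U = 1" using N_pos by (simp add: U_def coeff_1)
  then have "lead_coeff h = 1" using monic_g by (simp add: h lead_coeff_mult)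
  moreover have "ipoly 0 U" unfolding U_def by (intro ipoly_diff) (auto simp: ipoly_monom)
  ultimately have "ipoly 0 g" "ipoly 0 h"
    using monic_factor_integral[of g h] monic_factor_integral[of h g] monic_g
    by (simp_all add: h mult.commute)
  then show ?thesis using that h by (simp add: U_def)
qed

lemma ipoly_g: "ipoly 0 g" using factorization by blast

definition reduced :: "'k poly \<Rightarrow> bool" where
  "reduced r \<longleftrightarrow> (\<forall>i\<ge>degree g. coeff r i = 0)"

lemma reduced_unique:
  assumes "reduced q" "reduced r" "ev q \<omega> = ev r \<omega>"
  shows "q = r"
proof (rule ccontr)
  assume "q \<noteq> r"
  then have "degree g \<le> degree (q - r)" using assms(3) by (intro g_minimal) auto
  then have "coeff (q - r) (degree (q - r)) = 0" using assms(1,2) by (simp add: reduced_def)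
  then show False using \<open>q \<noteq> r\<close> by (simp only: leading_coeff_0_iff) simp
qed

lemma reduced_const [simp]: "reduced [:c:]"
  using degree_g_pos by (auto simp: reduced_def coeff_pCons split: nat.splits)

text \<open>Division by the monic integral polynomial \<open>g\<close> does not enlarge coefficients.\<close>

lemma reduce:
  assumes "ipoly k q"
  obtains r where "ipoly k r" "reduced r" "ev r \<omega> = ev q \<omega>"
proof -
  have "\<exists>r. ipoly k r \<and> reduced r \<and> ev r \<omega> = ev q \<omega>"
    if "ipoly k q" "\<forall>i\<ge>m. coeff q i = 0" for m q
    using that
  proof (induction m arbitrary: q)
    case 0
    then have "q = 0" by (simp add: poly_eq_iff)
    then show ?case by (intro exI[of _ 0]) (auto simp: reduced_def)
  next
    case (Suc m)
    show ?case
    proof (cases "m < degree g")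
      case True
      then show ?thesis using Suc.prems by (intro exI[of _ q]) (auto simp: reduced_def)
    next
      case False
      define q' where "q' = q - monom (coeff q m) (m - degree g) * g"
      have "ipoly (k + 0) (monom (coeff q m) (m - degree g) * g)"
        using Suc.prems(1) by (intro ipoly_mult ipoly_g) (simp add: ipoly_monom ipoly_def)
      then have "ipoly k q'" using Suc.prems(1) by (simp add: q'_def ipoly_diff)
      moreover have "\<forall>i\<ge>m. coeff q' i = 0"
      proof (intro allI impI)
        fix i assume "i \<ge> m"
        then consider "i = m" | "i > m" by linarith
        then show "coeff q' i = 0"
        proof cases
          case 1
          then show ?thesis using False monic_g by (simp add: q'_def coeff_monom_mult)
        next
          case 2
          then have "coeff g (i - (m - degree g)) = 0" using False by (intro coeff_eq_0) simp
          then show ?thesis using 2 False Suc.prems(2) by (simp add: q'_def coeff_monom_mult)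
        qed
      qed
      ultimately obtain r where "ipoly k r" "reduced r" "ev r \<omega> = ev q' \<omega>"
        using Suc.IH by blast
      then show ?thesis by (intro exI[of _ r]) (simp add: q'_def)
    qed
  qed
  from this[OF assms, of "Suc (degree q)"] show ?thesis
    using that by (auto simp: coeff_eq_0)
qed

text \<open>The ideal \<open>p ^ k R\<close> of the ring \<open>R\<close> generated by \<open>\<omega>\<close> over the \<open>p\<close>-adic integers.\<close>

definition P :: "nat \<Rightarrow> 'k alg_closure set" where
  "P k = {ev q \<omega> | q. ipoly k q}"

lemma P_I: "ipoly k q \<Longrightarrow> ev q \<omega> \<in> P k"
  by (auto simp: P_def)

lemma P_E:
  assumes "x \<in> P k" obtains r where "ipoly k r" "reduced r" "x = ev r \<omega>"
  using assms unfolding P_def by (auto elim: reduce)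

lemma P_0 [simp]: "0 \<in> P k" using P_I[of k 0] by simp

lemma P_add: "x \<in> P k \<Longrightarrow> y \<in> P k \<Longrightarrow> x + y \<in> P k"
  unfolding P_def by clarify (metis ev_add ipoly_add)

lemma P_diff: "x \<in> P k \<Longrightarrow> y \<in> P k \<Longrightarrow> x - y \<in> P k"
  unfolding P_def by clarify (metis ev_diff ipoly_diff)

lemma P_mult: "x \<in> P j \<Longrightarrow> y \<in> P k \<Longrightarrow> x * y \<in> P (j + k)"
  unfolding P_def by clarify (metis ev_mult ipoly_mult)

lemma P_mult_left: "x \<in> P 0 \<Longrightarrow> y \<in> P k \<Longrightarrow> x * y \<in> P k"
  and P_mult_right: "x \<in> P k \<Longrightarrow> y \<in> P 0 \<Longrightarrow> x * y \<in> P k"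
  using P_mult[of x 0 y k] P_mult[of x k y 0] by simp_all

lemma P_sum: "(\<And>a. a \<in> A \<Longrightarrow> f a \<in> P k) \<Longrightarrow> sum f A \<in> P k"
  by (induction A rule: infinite_finite_induct) (auto intro: P_add)

lemma P_mono: "x \<in> P k \<Longrightarrow> j \<le> k \<Longrightarrow> x \<in> P j"
  unfolding P_def using ipoly_mono by blast

lemma P_to_ac: "v c \<le> (1 / real p) ^ k \<Longrightarrow> to_ac c \<in> P k"
  using P_I[of k "[:c:]"] by (simp add: ipoly_pCons)

lemma P_1 [simp]: "1 \<in> P 0" using P_to_ac[of 1 0] by simp

lemma P_power: "x \<in> P 0 \<Longrightarrow> x ^ m \<in> P 0"
  by (induction m) (auto intro: P_mult_left)

lemma P_of_nat [simp]: "of_nat m \<in> P 0"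
  using P_to_ac[of "of_nat m" 0] v_of_nat_le_1 by simp

lemma P_p [simp]: "of_nat p \<in> P (Suc 0)"
  using P_to_ac[of "of_nat p" 1] v_p by simp

lemma P_\<omega> [simp]: "\<omega> \<in> P 0"
  using P_I[of 0 "monom 1 1"] by (simp add: ipoly_monom)

lemma P_to_ac_iff: "to_ac c \<in> P k \<longleftrightarrow> v c \<le> (1 / real p) ^ k"
proof
  assume "to_ac c \<in> P k"
  then obtain r where r: "ipoly k r" "reduced r" "to_ac c = ev r \<omega>" by (rule P_E)
  then have "r = [:c:]" by (intro reduced_unique) auto
  then show "v c \<le> (1 / real p) ^ k" using r(1) by (simp add: ipoly_pCons)
qed (rule P_to_ac)

lemma of_int_P: "of_int m \<in> P (Suc 0) \<longleftrightarrow> int p dvd m"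
proof -
  have "of_int m \<in> P (Suc 0) \<longleftrightarrow> v (of_int m) \<le> 1 / real p"
    using P_to_ac_iff[of "of_int m" "Suc 0"] by simp
  also have "\<dots> \<longleftrightarrow> int p dvd m"
  proof
    assume *: "v (of_int m) \<le> 1 / real p"
    also have "\<dots> < 1" using p_gt_1 by simp
    finally show "int p dvd m" using v_of_int_eq_1 by force
  next
    assume "int p dvd m"
    then obtain t where "m = int p * t" by blast
    then have "v (of_int m) = 1 / real p * v (of_int t)" by (simp add: v_p)
    also have "\<dots> \<le> 1 / real p * 1" using v_of_int_le_1 by (intro mult_left_mono) auto
    finally show "v (of_int m) \<le> 1 / real p" by simp
  qed
  finally show ?thesis .
qed

lemma P_Suc_E:
  assumes "x \<in> P k" obtains y where "y \<in> P 0" "x = of_nat p ^ k * y"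
proof -
  obtain q where q: "ipoly k q" "x = ev q \<omega>" using assms by (auto simp: P_def)
  define q' where "q' = smult (inverse (of_nat p ^ k)) q"
  have "v (inverse (of_nat p ^ k :: 'k)) * (1 / real p) ^ k = 1"
  proof -
    have "v (inverse (of_nat p ^ k) * of_nat p ^ k :: 'k) = v 1"
      using p_gt_1 by (intro arg_cong[of _ _ v] left_inverse) auto
    then show ?thesis by (simp only: v_mult v_power v_p v_1)
  qed
  moreover have "v (coeff q' i) \<le> v (inverse (of_nat p ^ k :: 'k)) * (1 / real p) ^ k" for i
    unfolding q'_def coeff_smult v_mult using q(1) by (intro mult_left_mono) (auto simp: ipoly_def)
  ultimately have "ipoly 0 q'" by (simp add: ipoly_def)
  then have "ev q' \<omega> \<in> P 0" by (rule P_I)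
  moreover have "x = of_nat p ^ k * ev q' \<omega>"
    using p_gt_1 by (simp add: q(2) q'_def)
  ultimately show ?thesis using that by blast
qed

lemma P_Inter: "(\<And>k. x \<in> P k) \<Longrightarrow> x = 0"
proof -
  assume x: "\<And>k. x \<in> P k"
  obtain r where r: "reduced r" "x = ev r \<omega>" using P_E[OF x[of 0]] by blast
  have "ipoly k r" for k
    using P_E[OF x[of k]] r reduced_unique by metis
  then have small: "v (coeff r i) \<le> (1 / real p) ^ k" for i k by (simp add: ipoly_def)
  have "coeff r i = 0" for i
  proof (rule ccontr)
    assume "coeff r i \<noteq> 0"
    then have "v (coeff r i) > 0" by (simp add: order_less_le)
    then obtain k where "(1 / real p) ^ k < v (coeff r i)"
      using p_gt_1 real_arch_pow_inv[of _ "1 / real p"] by auto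
    then show False using small[of i k] by simp
  qed
  then have "r = 0" by (simp add: poly_eq_iff)
  then show "x = 0" using r by simp
qed

text \<open>The inner binomial coefficients are divisible by \<open>p\<close>.\<close>

lemma frobenius_add:
  assumes "x \<in> P 0" "y \<in> P 0"
  shows "(x + y) ^ p - (x ^ p + y ^ p) \<in> P (Suc 0)"
proof -
  have "(x + y) ^ p = (\<Sum>i\<le>p. of_nat (p choose i) * x ^ i * y ^ (p - i))"
    by (rule binomial_ring)
  also have "{..p} = insert 0 (insert p {0<..<p})" by auto
  also have "(\<Sum>i\<in>insert 0 (insert p {0<..<p}). of_nat (p choose i) * x ^ i * y ^ (p - i)) =
     x ^ p + y ^ p + (\<Sum>i\<in>{0<..<p}. of_nat (p choose i) * x ^ i * y ^ (p - i))"
    using p_gt_1 by (simp add: algebra_simps)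
  finally have "(x + y) ^ p - (x ^ p + y ^ p) =
      (\<Sum>i\<in>{0<..<p}. of_nat (p choose i) * x ^ i * y ^ (p - i))" by simp
  also have "\<dots> \<in> P (Suc 0)"
  proof (intro P_sum P_mult_right P_power assms)
    fix i assume "i \<in> {0<..<p}"
    then have "p dvd (p choose i)" by (intro dvd_choose_prime) (auto simp: prime_p)
    then show "of_nat (p choose i) \<in> P (Suc 0)"
      using of_int_P[of "int (p choose i)"] by simp
  qed
  finally show ?thesis .
qed

text \<open>The \<open>p\<close>-th power is additive modulo \<open>p\<close> and fixes the coefficients modulo \<open>p\<close>, so it acts
  modulo \<open>p\<close> like the substitution of \<open>\<omega> ^ p\<close> for \<open>\<omega>\<close>. It is this congruence that singles
  out the Frobenius automorphism.\<close>

lemma frobenius_lift: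
  assumes "ipoly 0 q"
  shows "ev q \<omega> ^ p - ev q (\<omega> ^ p) \<in> P (Suc 0)"
  using assms
proof (induction q)
  case 0
  then show ?case using p_gt_1 by (simp add: power_0_left)
next
  case (pCons a q)
  then have a: "v a \<le> 1" and q: "ipoly 0 q" by (auto simp: ipoly_pCons)
  have "(to_ac a + \<omega> * ev q \<omega>) ^ p - (to_ac a ^ p + (\<omega> * ev q \<omega>) ^ p) \<in> P (Suc 0)"
    using a q by (intro frobenius_add P_mult_left P_I P_to_ac) auto
  moreover have "to_ac (a ^ p - a) \<in> P (Suc 0)"
    using residue_frobenius[OF a] by (intro P_to_ac) simp
  moreover have "\<omega> ^ p * (ev q \<omega> ^ p - ev q (\<omega> ^ p)) \<in> P (Suc 0)"
    using pCons q by (intro P_mult_left P_power) auto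
  ultimately have "(to_ac a + \<omega> * ev q \<omega>) ^ p - (to_ac a ^ p + (\<omega> * ev q \<omega>) ^ p)
     + to_ac (a ^ p - a) + \<omega> ^ p * (ev q \<omega> ^ p - ev q (\<omega> ^ p)) \<in> P (Suc 0)"
    by (intro P_add)
  then show ?case by (simp add: algebra_simps power_mult_distrib)
qed

lemma power_cong:
  assumes "x \<in> P 0" "y \<in> P 0" "x - y \<in> P k"
  shows "x ^ m - y ^ m \<in> P k"
  unfolding power_diff_sumr2
  using assms by (intro P_mult_right P_sum P_mult_left P_power)

text \<open>The cofactor of \<open>x - y\<close> in \<open>x ^ p - y ^ p\<close> is a sum of \<open>p\<close> terms, each congruent to
  \<open>y ^ (p - 1)\<close>, so it contributes another factor \<open>p\<close>. This gain makes the sequence of iterated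
  \<open>p\<close>-th powers converge.\<close>

lemma power_p_cong:
  assumes "x \<in> P 0" "y \<in> P 0" "x - y \<in> P (Suc k)"
  shows "x ^ p - y ^ p \<in> P (Suc (Suc k))"
proof -
  have "y ^ (p - Suc i) * x ^ i - y ^ (p - 1) \<in> P (Suc 0)" if "i < p" for i
  proof -
    have "y ^ (p - Suc i) * (x ^ i - y ^ i) \<in> P (Suc 0)"
      using assms by (intro P_mult_left P_power power_cong P_mono[OF assms(3)]) auto
    moreover have "y ^ (p - Suc i) * y ^ i = y ^ (p - 1)"
      using that by (simp flip: power_add)
    ultimately show ?thesis by (simp add: algebra_simps)
  qed
  then have "(\<Sum>i<p. y ^ (p - Suc i) * x ^ i - y ^ (p - 1)) + of_nat p * y ^ (p - 1) \<in> P (Suc 0)"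
    using assms by (intro P_add P_sum P_mult_right[OF P_p] P_power) auto
  then have "(\<Sum>i<p. y ^ (p - Suc i) * x ^ i) \<in> P (Suc 0)"
    by (simp add: sum_subtractf)
  from P_mult[OF assms(3) this] show ?thesis
    by (simp add: power_diff_sumr2)
qed

text \<open>Differentiating \<open>X ^ N - 1 = g * h\<close> at \<open>\<omega>\<close> shows that \<open>h (\<omega>)\<close> divides the unit multiple
  \<open>N * \<omega> ^ (N - 1)\<close> of \<open>N\<close>, which is prime to \<open>p\<close>; hence \<open>p\<close> divides no
  power of \<open>h (\<omega>)\<close>.\<close>

lemma separable_mod_p:
  assumes "monom 1 N - 1 = g * h" "ipoly 0 h"
  shows "ev h \<omega> ^ p \<notin> P (Suc 0)"
proof
  assume hp: "ev h \<omega> ^ p \<in> P (Suc 0)"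
  define u where "u = ev (pderiv g) \<omega> * \<omega>"
  have "ipoly 0 (pderiv g)"
    unfolding ipoly_def
  proof
    fix i
    have "v (of_nat (Suc i)) * v (coeff g (Suc i)) \<le> 1 * 1"
      using ipoly_g by (intro mult_mono v_of_nat_le_1) (auto simp: ipoly_def)
    then show "v (coeff (pderiv g) i) \<le> (1 / real p) ^ 0"
      by (simp add: coeff_pderiv)
  qed
  then have u: "u \<in> P 0" unfolding u_def by (intro P_mult_left P_I P_\<omega>)
  have "pderiv (monom 1 N - 1 :: 'k poly) = monom (of_nat N) (N - 1)"
    by (simp add: pderiv_diff pderiv_monom)
  then have "ev (monom (of_nat N) (N - 1)) \<omega> = ev (pderiv (g * h)) \<omega>"
    using assms(1) by simp
  then have "of_nat N * \<omega> ^ (N - 1) = ev (pderiv g) \<omega> * ev h \<omega>"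
    by (simp only: ev_monom pderiv_mult ev_add ev_mult ev_g to_ac_of_nat) (simp add: mult.commute)
  then have "of_nat N * \<omega> ^ (N - 1) * \<omega> = u * ev h \<omega>" by (simp add: u_def)
  moreover have "\<omega> ^ (N - 1) * \<omega> = 1"
    using N_pos \<omega>_power_N by (metis Suc_pred' power_Suc2 One_nat_def)
  ultimately have eq: "of_nat N = u * ev h \<omega>" by (simp add: mult.assoc)
  then have "of_nat N ^ p = u ^ p * ev h \<omega> ^ p" by (simp add: power_mult_distrib)
  then have "of_nat N ^ p \<in> P (Suc 0)" using u hp by (simp add: P_mult_left P_power)
  then have "of_int (int (N ^ p)) \<in> P (Suc 0)" by simp
  then have "int p dvd int (N ^ p)" using of_int_P by blast
  then have "p dvd N" using prime_p prime_dvd_power int_dvd_int_iff by blast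
  moreover have "p dvd p ^ n" using n_pos by simp
  ultimately have "p dvd p ^ n - N" by (rule dvd_diff_nat[rotated])
  moreover have "p ^ n - N = 1" using p_gt_1 by (simp add: N_def)
  ultimately show False using p_gt_1 by simp
qed

text \<open>The key point: \<open>\<omega>\<close> and \<open>\<omega> ^ p\<close> are conjugate. Otherwise \<open>\<omega> ^ p\<close> is a root of
  the cofactor \<open>h\<close> of \<open>g\<close> in \<open>X ^ N - 1\<close>, hence \<open>h (\<omega>) ^ p\<close> is divisible by \<open>p\<close>, against the
  separability of \<open>X ^ N - 1\<close> modulo \<open>p\<close>.\<close>

lemma ev_g_frobenius: "ev g (\<omega> ^ p) = 0"
proof (rule ccontr)
  assume nz: "ev g (\<omega> ^ p) \<noteq> 0"
  obtain h where h: "monom 1 N - 1 = g * h" "ipoly 0 h" using factorization by blast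
  have "ev g (\<omega> ^ p) * ev h (\<omega> ^ p) = ev (monom 1 N - 1) (\<omega> ^ p)" by (simp add: h(1))
  also have "\<dots> = (\<omega> ^ N) ^ p - 1" by (simp only: ev_diff ev_monom ev_1 to_ac_1 mult_1 mult.commute flip: power_mult)
  also have "\<dots> = 0" by simp
  finally have "ev h (\<omega> ^ p) = 0" using nz by simp
  then have "ev h \<omega> ^ p \<in> P (Suc 0)" using frobenius_lift[OF h(2)] by simp
  then show False using separable_mod_p[OF h] by simp
qed

definition L :: "'k alg_closure set" where "L = range (\<lambda>q. ev q \<omega>)"

text \<open>The value does not depend on the chosen polynomial because \<open>\<omega> ^ p\<close> is a root of \<open>g\<close>.\<close>

definition \<phi> :: "'k alg_closure \<Rightarrow> 'k alg_closure" where
  "\<phi> x = ev (SOME q. ev q \<omega> = x) (\<omega> ^ p)"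

lemma \<phi>_ev: "\<phi> (ev q \<omega>) = ev q (\<omega> ^ p)"
proof -
  define r where "r = (SOME r. ev r \<omega> = ev q \<omega>)"
  have "ev r \<omega> = ev q \<omega>" unfolding r_def by (rule someI) simp
  then have "g dvd r - q" by (simp flip: g_dvd_iff)
  then obtain s where "r - q = g * s" by blast
  then have "ev r (\<omega> ^ p) - ev q (\<omega> ^ p) = ev g (\<omega> ^ p) * ev s (\<omega> ^ p)"
    by (metis ev_diff ev_mult)
  then show ?thesis by (simp add: \<phi>_def r_def ev_g_frobenius)
qed

lemma L_E: assumes "x \<in> L" obtains q where "x = ev q \<omega>"
  using assms by (auto simp: L_def)

lemma L_ev [simp]: "ev q \<omega> \<in> L" by (simp add: L_def)

lemma L_to_ac [simp]: "to_ac c \<in> L" using L_ev[of "[:c:]"] by simp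
lemma L_\<omega> [simp]: "\<omega> \<in> L" using L_ev[of "monom 1 1"] by simp
lemma L_add: "x \<in> L \<Longrightarrow> y \<in> L \<Longrightarrow> x + y \<in> L" by (metis L_E L_ev ev_add)
lemma L_mult: "x \<in> L \<Longrightarrow> y \<in> L \<Longrightarrow> x * y \<in> L" by (metis L_E L_ev ev_mult)
lemma L_power: "x \<in> L \<Longrightarrow> x ^ m \<in> L"
  using L_to_ac[of 1] by (induction m) (auto intro: L_mult)
lemma P_L: "x \<in> P k \<Longrightarrow> x \<in> L" by (auto simp: P_def)

lemma \<phi>_L: "x \<in> L \<Longrightarrow> \<phi> x \<in> L"
proof -
  assume "x \<in> L"
  then obtain q where q: "x = ev q \<omega>" by (rule L_E)
  have "ev q (\<omega> ^ p) = ev (pcompose q (monom 1 p)) \<omega>"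
    by (induction q) (simp_all add: pcompose_pCons)
  then show ?thesis by (simp add: q \<phi>_ev)
qed

lemma \<phi>_to_ac [simp]: "\<phi> (to_ac c) = to_ac c" using \<phi>_ev[of "[:c:]"] by simp
lemma \<phi>_\<omega> [simp]: "\<phi> \<omega> = \<omega> ^ p" using \<phi>_ev[of "monom 1 1"] by simp
lemma \<phi>_add: "x \<in> L \<Longrightarrow> y \<in> L \<Longrightarrow> \<phi> (x + y) = \<phi> x + \<phi> y"
  by (metis L_E ev_add \<phi>_ev)
lemma \<phi>_diff: "x \<in> L \<Longrightarrow> y \<in> L \<Longrightarrow> \<phi> (x - y) = \<phi> x - \<phi> y"
  by (metis L_E ev_diff \<phi>_ev)
lemma \<phi>_mult: "x \<in> L \<Longrightarrow> y \<in> L \<Longrightarrow> \<phi> (x * y) = \<phi> x * \<phi> y"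
  by (metis L_E ev_mult \<phi>_ev)

lemma frobenius_mod_p: "x \<in> P 0 \<Longrightarrow> x ^ p - \<phi> x \<in> P (Suc 0)"
  by (auto simp: P_def \<phi>_ev intro: frobenius_lift[unfolded P_def, simplified])

text \<open>Completeness of the base field, applied to each coordinate with respect to the powers of \<open>\<omega>\<close>
  below the degree of \<open>g\<close>.\<close>

lemma P_complete:
  assumes z0: "z 0 \<in> P 0" and z: "\<And>m. z (Suc m) - z m \<in> P m"
  obtains w where "w \<in> P 0" "\<And>m. w - z m \<in> P m"
proof -
  have "\<forall>m. \<exists>q. ipoly m q \<and> reduced q \<and> z (Suc m) - z m = ev q \<omega>"
    using P_E[OF z] by metis
  then obtain q where q: "\<And>m. ipoly m (q m)" "\<And>m. reduced (q m)"
      "\<And>m. z (Suc m) - z m = ev (q m) \<omega>" by metis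
  have "\<exists>s. \<forall>m. v (s - (\<Sum>j<m. coeff (q j) i)) \<le> (1 / real p) ^ m" for i
    using series_limit[of "\<lambda>j. coeff (q j) i"] q(1) unfolding ipoly_def by metis
  then obtain s where s: "\<And>i m. v (s i - (\<Sum>j<m. coeff (q j) i)) \<le> (1 / real p) ^ m" by metis
  define Q where "Q = (\<Sum>i<degree g. monom (s i) i)"
  have coeff_Q: "coeff Q i = (if i < degree g then s i else 0)" for i
    by (simp add: Q_def coeff_sum)
  have tail: "ipoly m (Q - (\<Sum>j<m. q j))" for m
    unfolding ipoly_def coeff_diff coeff_sum coeff_Q
    using s q(2) p_gt_1 by (auto simp: reduced_def)
  have z_eq: "z m = z 0 + ev (\<Sum>j<m. q j) \<omega>" for m
  proof (induction m)
    case (Suc m)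
    then show ?case using q(3)[of m] by (simp add: algebra_simps)
  qed simp
  define w where "w = z 0 + ev Q \<omega>"
  have *: "w - z m \<in> P m" for m
    using P_I[OF tail[of m]] by (subst z_eq) (simp add: w_def)
  moreover have "w \<in> P 0" using P_add[OF *[of 0] z0] by simp
  ultimately show ?thesis using that by blast
qed

text \<open>The limit of the iterated \<open>p\<close>-th powers of \<open>x\<close>.\<close>

lemma teichmueller:
  assumes x: "x \<in> P 0" and xp: "x ^ p - x \<in> P (Suc 0)"
  obtains t where "t \<in> P 0" "t ^ p = t" "t - x \<in> P (Suc 0)"
proof -
  define z where "z k = x ^ (p ^ k)" for k
  have z0: "z k \<in> P 0" for k using x by (simp add: z_def P_power)
  have zS: "z (Suc k) = z k ^ p" for k
    by (simp add: z_def mult.commute flip: power_mult)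
  have step: "z (Suc k) - z k \<in> P (Suc k)" for k
  proof (induction k)
    case 0
    then show ?case using xp by (simp add: z_def)
  next
    case (Suc k)
    then show ?case
      using power_p_cong[OF z0 z0 Suc] by (simp add: zS)
  qed
  obtain w where w: "w \<in> P 0" "\<And>m. w - z m \<in> P m"
    using P_complete[of z] z0 P_mono[OF step] by (metis le_SucI order_refl)
  have "w ^ p - w \<in> P m" for m
  proof -
    have "(w ^ p - z m ^ p) + (z (Suc m) - z m) - (w - z m) \<in> P m"
    proof (intro P_diff[OF P_add])
      show "w ^ p - z m ^ p \<in> P m" using w z0 by (intro power_cong)
      show "z (Suc m) - z m \<in> P m" by (rule P_mono[OF step]) simp
      show "w - z m \<in> P m" by (rule w(2))
    qed
    then show ?thesis by (simp add: zS)
  qed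
  then have "w ^ p = w" using P_Inter by fastforce
  moreover have "w - x \<in> P (Suc 0)"
    using P_add[OF w(2)[of "Suc 0"] step[of 0]] by (simp add: z_def)
  ultimately show ?thesis using that w(1) by blast
qed

text \<open>The Teichmueller lifts of \<open>0, \<dots>, p - 1\<close> are \<open>p\<close> distinct roots of \<open>X ^ p - X\<close>, hence all its
  roots. The lift of a fixed element \<open>x\<close>, which exists because \<open>x ^ p\<close> is congruent to
  \<open>\<phi> x = x\<close>, is one of them.\<close>

lemma residue_fixed:
  assumes "x \<in> P 0" "\<phi> x = x"
  obtains c :: nat where "x - of_nat c \<in> P (Suc 0)"
proof -
  define T where "T = {t :: 'k alg_closure. ev (monom 1 p - monom 1 1) t = 0}"
  have T: "t \<in> T \<longleftrightarrow> t ^ p = t" for t by (simp add: T_def)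
  define U :: "'k poly" where "U = monom 1 p - monom 1 1"
  have "coeff U p = 1" using p_gt_1 by (simp add: U_def)
  then have "U \<noteq> 0" by auto
  moreover have "degree U \<le> p"
    unfolding U_def using p_gt_1 by (intro degree_diff_le) (auto simp: degree_monom_eq)
  ultimately have finT: "finite T" "card T \<le> p"
    using ev_root_finite[of U] unfolding T_def U_def[symmetric] by auto
  have "\<exists>t. t \<in> T \<and> t - of_nat c \<in> P (Suc 0)" for c :: nat
  proof -
    have "of_int (int c ^ p - int c) \<in> P (Suc 0)"
      unfolding of_int_P by (rule int_power_p_cong)
    then have "of_nat c ^ p - of_nat c \<in> P (Suc 0)" by simp
    then show ?thesis using teichmueller[of "of_nat c"] T by (metis P_of_nat)
  qed
  then obtain \<tau> where \<tau>: "\<And>c. \<tau> c \<in> T" "\<And>c. \<tau> c - of_nat c \<in> P (Suc 0)" by metis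
  have "inj_on \<tau> {..<p}"
  proof (rule inj_onI)
    fix c d assume cd: "c \<in> {..<p}" "d \<in> {..<p}" "\<tau> c = \<tau> d"
    have "(\<tau> d - of_nat d) - (\<tau> c - of_nat c) \<in> P (Suc 0)" using \<tau>(2)[of d] \<tau>(2)[of c] by (rule P_diff)
    then have "of_int (int c - int d) \<in> P (Suc 0)" using cd by simp
    then have "int p dvd int c - int d" by (simp only: of_int_P)
    then show "c = d" using cd by (metis lessThan_iff mod_eq_dvd_iff mod_less of_nat_eq_iff zmod_int)
  qed
  then have "card (\<tau> ` {..<p}) = p" by (simp add: card_image)
  then have "\<tau> ` {..<p} = T" using finT \<tau>(1) by (intro card_seteq) auto
  moreover obtain t where "t \<in> T" "t - x \<in> P (Suc 0)"
    using teichmueller[of x] frobenius_mod_p[of x] assms T by metis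
  ultimately obtain c where c: "\<tau> c - x \<in> P (Suc 0)" by auto
  have "(\<tau> c - of_nat c) - (\<tau> c - x) \<in> P (Suc 0)" using \<tau>(2) c by (rule P_diff)
  then show ?thesis using that by simp
qed

text \<open>By successive approximation, an integral element fixed by \<open>\<phi>\<close> lies in the base modulo every
  power of \<open>p\<close>, so its coordinates other than the constant one vanish.\<close>

lemma integral_fixed:
  assumes "x \<in> P 0" "\<phi> x = x"
  shows "x \<in> range to_ac"
proof -
  have p0: "(of_nat p :: 'k alg_closure) \<noteq> 0" using p_gt_1 by simp
  have approx: "\<exists>c. x - to_ac c \<in> P k" for k
  proof (induction k)
    case 0
    show ?case using assms by (intro exI[of _ 0]) simp
  next
    case (Suc k)
    then obtain c where c: "x - to_ac c \<in> P k" by blast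
    then obtain y where y: "y \<in> P 0" "x - to_ac c = of_nat p ^ k * y" by (rule P_Suc_E)
    have pk: "of_nat p ^ k = to_ac (of_nat p ^ k)" by simp
    have "\<phi> (x - to_ac c) = x - to_ac c"
      using assms by (simp add: \<phi>_diff P_L)
    then have "of_nat p ^ k * \<phi> y = of_nat p ^ k * y"
      unfolding y(2) pk using y(1) by (subst (asm) \<phi>_mult) (auto simp: P_L simp del: to_ac_power)
    then have "\<phi> y = y" using p0 by simp
    then obtain d :: nat where d: "y - of_nat d \<in> P (Suc 0)" using residue_fixed y(1) by blast
    have "to_ac (of_nat p ^ k) \<in> P k" by (intro P_to_ac) (simp add: v_p)
    from P_mult[OF this d] have "x - to_ac c - to_ac (of_nat p ^ k * of_nat d) \<in> P (Suc k)"
      unfolding y(2) by (simp add: algebra_simps)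
    then show ?case
      by (intro exI[of _ "c + of_nat p ^ k * of_nat d"]) (simp add: algebra_simps)
  qed
  obtain r where r: "reduced r" "x = ev r \<omega>" using P_E[OF assms(1)] by blast
  obtain c where c: "\<And>k. x - to_ac (c k) \<in> P k" using approx by metis
  have small: "v (coeff r (Suc i)) \<le> (1 / real p) ^ k" for i k
  proof -
    obtain s where s: "ipoly k s" "reduced s" "x - to_ac (c k) = ev s \<omega>" using P_E[OF c] by metis
    have "r - [:c k:] = s"
      using r s reduced_const[of "c k"] by (intro reduced_unique) (auto simp: reduced_def)
    then have "coeff s (Suc i) = coeff r (Suc i)" by auto
    then show ?thesis using ipolyD[OF s(1)] by metis
  qed
  have "coeff r (Suc i) = 0" for i
  proof (rule ccontr)
    assume "coeff r (Suc i) \<noteq> 0"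
    then have "to_ac (coeff r (Suc i)) \<noteq> 0" by simp
    moreover have "to_ac (coeff r (Suc i)) \<in> P k" for k using small by (intro P_to_ac)
    ultimately show False using P_Inter by blast
  qed
  then have "r = [:coeff r 0:]" by (auto simp: poly_eq_iff coeff_pCons split: nat.splits)
  then have "x = to_ac (coeff r 0)" using r(2) by (metis ev_pCons ev_0 mult_zero_right add_0_right)
  then show ?thesis by blast
qed

theorem fixed_field:
  assumes "x \<in> L" "\<phi> x = x"
  shows "x \<in> range to_ac"
proof -
  obtain q where q: "x = ev q \<omega>" using assms(1) by (rule L_E)
  define M where "M = (\<Sum>i\<le>degree q. v (coeff q i))"
  have le_M: "v (coeff q i) \<le> M" for i
  proof (cases "i \<le> degree q")
    case True
    then show ?thesis unfolding M_def by (intro member_le_sum) auto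
  qed (auto simp: coeff_eq_0 M_def sum_nonneg)
  obtain m where m: "M < real p ^ m" using p_gt_1 by (metis real_arch_pow of_nat_1 of_nat_less_iff)
  define c :: 'k where "c = of_nat p ^ m"
  have c: "c \<noteq> 0" "v c = (1 / real p) ^ m" using p_gt_1 by (simp_all add: c_def v_p)
  have "ipoly 0 (smult c q)"
    unfolding ipoly_def
  proof
    fix i
    have "v c * v (coeff q i) \<le> (1 / real p) ^ m * real p ^ m"
      unfolding c(2) using le_M[of i] m by (intro mult_left_mono) auto
    also have "\<dots> = 1" using p_gt_1 by (simp flip: power_mult_distrib)
    finally show "v (coeff (smult c q) i) \<le> (1 / real p) ^ 0" by simp
  qed
  then have "to_ac c * x \<in> P 0" using P_I[of 0 "smult c q"] by (simp add: q)
  moreover have "\<phi> (to_ac c * x) = to_ac c * x" using assms by (simp add: \<phi>_mult)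
  ultimately obtain b where "to_ac c * x = to_ac b" using integral_fixed by blast
  then have "x = to_ac (b / c)" using c by (simp add: field_simps)
  then show ?thesis by blast
qed

end

section \<open>Cyclic extensions with a primitive element\<close>

text \<open>The generator \<open>\<phi>\<close> of the Galois group is represented by a function on the whole algebraic
  closure of which only the values on \<open>L\<close> are constrained. All structure on \<open>L\<close> is
  derived from a primitive element \<open>\<theta>\<close> with \<open>n\<close> distinct conjugates.\<close>

locale cyclic_extension =
  fixes L :: "'k :: field_char_0 alg_closure set" and \<phi> :: "'k alg_closure \<Rightarrow> 'k alg_closure"
    and n :: nat and \<theta> :: "'k alg_closure"
  assumes n_pos: "n > 0"
    and primitive: "L = range (\<lambda>q. ev q \<theta>)"
    and conjugates: "inj_on (\<lambda>i. (\<phi> ^^ i) \<theta>) {..<n}"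
    and \<phi>_L [simp]: "x \<in> L \<Longrightarrow> \<phi> x \<in> L"
    and \<phi>_add: "x \<in> L \<Longrightarrow> y \<in> L \<Longrightarrow> \<phi> (x + y) = \<phi> x + \<phi> y"
    and \<phi>_mult: "x \<in> L \<Longrightarrow> y \<in> L \<Longrightarrow> \<phi> (x * y) = \<phi> x * \<phi> y"
    and \<phi>_to_ac [simp]: "\<phi> (to_ac c) = to_ac c"
    and \<phi>_order: "x \<in> L \<Longrightarrow> (\<phi> ^^ n) x = x"
    and fixed_field: "x \<in> L \<Longrightarrow> \<phi> x = x \<Longrightarrow> x \<in> range to_ac"
begin

lemma L_E: assumes "x \<in> L" obtains q where "x = ev q \<theta>"
  using assms by (auto simp: primitive)

lemma L_ev [simp]: "ev q \<theta> \<in> L" by (simp add: primitive)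

lemma L_to_ac [simp]: "to_ac c \<in> L" using L_ev[of "[:c:]"] by simp
lemma L_\<theta> [simp]: "\<theta> \<in> L" using L_ev[of "monom 1 1"] by simp
lemma L_0 [simp]: "0 \<in> L" using L_to_ac[of 0] by simp
lemma L_1 [simp]: "1 \<in> L" using L_to_ac[of 1] by simp
lemma L_add [simp]: "x \<in> L \<Longrightarrow> y \<in> L \<Longrightarrow> x + y \<in> L" by (metis L_E L_ev ev_add)
lemma L_mult [simp]: "x \<in> L \<Longrightarrow> y \<in> L \<Longrightarrow> x * y \<in> L" by (metis L_E L_ev ev_mult)
lemma L_minus [simp]: "x \<in> L \<Longrightarrow> - x \<in> L" by (metis L_E L_ev ev_minus)
lemma L_diff [simp]: "x \<in> L \<Longrightarrow> y \<in> L \<Longrightarrow> x - y \<in> L" by (metis L_E L_ev ev_diff)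
lemma L_power [simp]: "x \<in> L \<Longrightarrow> x ^ m \<in> L" by (induction m) auto
lemma L_sum [simp]: "(\<And>a. a \<in> A \<Longrightarrow> f a \<in> L) \<Longrightarrow> sum f A \<in> L"
  by (induction A rule: infinite_finite_induct) auto
lemma L_prod [simp]: "(\<And>a. a \<in> A \<Longrightarrow> f a \<in> L) \<Longrightarrow> prod f A \<in> L"
  by (induction A rule: infinite_finite_induct) auto

lemma iter_L [simp]: "x \<in> L \<Longrightarrow> (\<phi> ^^ i) x \<in> L" by (induction i) auto
lemma iter_to_ac [simp]: "(\<phi> ^^ i) (to_ac c) = to_ac c" by (induction i) auto
lemma iter_add: "x \<in> L \<Longrightarrow> y \<in> L \<Longrightarrow> (\<phi> ^^ i) (x + y) = (\<phi> ^^ i) x + (\<phi> ^^ i) y"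
  by (induction i) (auto simp: \<phi>_add)
lemma iter_mult: "x \<in> L \<Longrightarrow> y \<in> L \<Longrightarrow> (\<phi> ^^ i) (x * y) = (\<phi> ^^ i) x * (\<phi> ^^ i) y"
  by (induction i) (auto simp: \<phi>_mult)
lemma iter_0 [simp]: "(\<phi> ^^ i) 0 = 0" using iter_to_ac[of i 0] by simp
lemma iter_1 [simp]: "(\<phi> ^^ i) 1 = 1" using iter_to_ac[of i 1] by simp
lemma iter_minus: "x \<in> L \<Longrightarrow> (\<phi> ^^ i) (- x) = - (\<phi> ^^ i) x"
  using iter_mult[of "to_ac (- 1)" x i] iter_to_ac[of i "- 1"] by simp
lemma iter_diff: "x \<in> L \<Longrightarrow> y \<in> L \<Longrightarrow> (\<phi> ^^ i) (x - y) = (\<phi> ^^ i) x - (\<phi> ^^ i) y"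
  using iter_add[of x "- y" i] by (simp add: iter_minus)
lemma iter_power: "x \<in> L \<Longrightarrow> (\<phi> ^^ i) (x ^ m) = (\<phi> ^^ i) x ^ m"
  by (induction m) (auto simp: iter_mult)
lemma iter_sum: "(\<And>a. a \<in> A \<Longrightarrow> f a \<in> L) \<Longrightarrow> (\<phi> ^^ i) (sum f A) = (\<Sum>a\<in>A. (\<phi> ^^ i) (f a))"
  by (induction A rule: infinite_finite_induct) (auto simp: iter_add)
lemma iter_prod: "(\<And>a. a \<in> A \<Longrightarrow> f a \<in> L) \<Longrightarrow> (\<phi> ^^ i) (prod f A) = (\<Prod>a\<in>A. (\<phi> ^^ i) (f a))"
  by (induction A rule: infinite_finite_induct) (auto simp: iter_mult)
lemma iter_ev: "x \<in> L \<Longrightarrow> (\<phi> ^^ i) (ev q x) = ev q ((\<phi> ^^ i) x) \<and> ev q x \<in> L"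
  by (induction q) (auto simp: iter_add iter_mult)

lemmas \<phi>_0 = iter_0[of 1, simplified] and \<phi>_1 = iter_1[of 1, simplified]
  and \<phi>_minus = iter_minus[of _ 1, simplified] and \<phi>_diff = iter_diff[of _ _ 1, simplified]
  and \<phi>_power = iter_power[of _ 1, simplified]
  and \<phi>_sum = iter_sum[of _ _ 1, simplified] and \<phi>_prod = iter_prod[of _ _ 1, simplified]

lemma iter_iter: "(\<phi> ^^ i) ((\<phi> ^^ j) x) = (\<phi> ^^ (i + j)) x"
  by (simp add: funpow_add)

lemma iter_mult_order: "x \<in> L \<Longrightarrow> (\<phi> ^^ (n * i)) x = x"
  by (induction i) (simp_all add: funpow_add \<phi>_order)

lemma iter_mod: "x \<in> L \<Longrightarrow> (\<phi> ^^ (i mod n)) x = (\<phi> ^^ i) x"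
proof -
  assume "x \<in> L"
  then have "(\<phi> ^^ (i mod n + n * (i div n))) x = (\<phi> ^^ (i mod n)) x"
    by (simp only: funpow_add o_apply iter_mult_order)
  then show ?thesis by simp
qed

lemma bij_\<phi>: "bij_betw \<phi> L L"
proof (rule bij_betw_byWitness[of _ "\<phi> ^^ (n - 1)"])
  have "(\<phi> ^^ (n - 1)) (\<phi> x) = (\<phi> ^^ n) x" "\<phi> ((\<phi> ^^ (n - 1)) x) = (\<phi> ^^ n) x" for x
    using n_pos funpow_swap1[of \<phi> "n - 1" x] by (cases n; simp)+
  then show "\<forall>x\<in>L. (\<phi> ^^ (n - 1)) (\<phi> x) = x" "\<forall>x\<in>L. \<phi> ((\<phi> ^^ (n - 1)) x) = x"
    using \<phi>_order by simp_all
qed auto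

lemma bij_funpow: "bij_betw (\<phi> ^^ i) L L"
  by (rule bij_betw_funpow[OF bij_\<phi>])

lemma iter_eq_iff: "x \<in> L \<Longrightarrow> y \<in> L \<Longrightarrow> (\<phi> ^^ i) x = (\<phi> ^^ i) y \<longleftrightarrow> x = y"
  using bij_funpow[of i] by (auto simp: bij_betw_def inj_on_def)

lemma iter_eq_0_iff [simp]: "x \<in> L \<Longrightarrow> (\<phi> ^^ i) x = 0 \<longleftrightarrow> x = 0"
  using iter_eq_iff[of x 0 i] by simp

lemma \<phi>_eq_0_iff [simp]: "x \<in> L \<Longrightarrow> \<phi> x = 0 \<longleftrightarrow> x = 0"
  using iter_eq_0_iff[of x 1] by simp

lemma norm_in_base:
  assumes "x \<in> L"
  shows "(\<Prod>i<n. (\<phi> ^^ i) x) \<in> range to_ac"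
proof (cases "x = 0")
  case True
  then have "(\<Prod>i<n. (\<phi> ^^ i) x) = to_ac 0" using n_pos by (auto intro!: prod_zero)
  then show ?thesis by blast
next
  case False
  have "x * (\<Prod>i<n. (\<phi> ^^ Suc i) x) = (\<Prod>i<Suc n. (\<phi> ^^ i) x)"
    by (subst prod.lessThan_Suc_shift) simp
  also have "\<dots> = (\<Prod>i<n. (\<phi> ^^ i) x) * x"
    using assms by (simp add: \<phi>_order del: funpow.simps)
  finally have "(\<Prod>i<n. (\<phi> ^^ Suc i) x) = (\<Prod>i<n. (\<phi> ^^ i) x)" using False by simp
  then show ?thesis using assms by (intro fixed_field) (auto simp: \<phi>_prod)
qed

lemma trace_invariant:
  assumes "x \<in> L"
  shows "(\<Sum>i<n. (\<phi> ^^ i) (\<phi> x)) = (\<Sum>i<n. (\<phi> ^^ i) x)"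
proof -
  have "x + (\<Sum>i<n. (\<phi> ^^ Suc i) x) = (\<Sum>i<Suc n. (\<phi> ^^ i) x)"
    by (subst sum.lessThan_Suc_shift) simp
  also have "\<dots> = (\<Sum>i<n. (\<phi> ^^ i) x) + x"
    using assms by (simp add: \<phi>_order del: funpow.simps)
  finally show ?thesis by (simp add: funpow_swap1)
qed

lemma trace_in_base:
  assumes "x \<in> L"
  shows "(\<Sum>i<n. (\<phi> ^^ i) x) \<in> range to_ac"
  using trace_invariant[OF assms] assms
  by (intro fixed_field) (auto simp: \<phi>_sum funpow_swap1)

text \<open>The norm of \<open>x\<close> lies in the base field, so its cofactor is an inverse of \<open>x\<close> up to a
  scalar.\<close>

lemma L_inverse [simp]:
  assumes "x \<in> L"
  shows "inverse x \<in> L"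
proof (cases "x = 0")
  case False
  obtain c where c: "(\<Prod>i<n. (\<phi> ^^ i) x) = to_ac c" using norm_in_base[OF assms] by blast
  have "to_ac c \<noteq> 0" using False assms by (simp flip: c)
  have "{..<n} = insert 0 {0<..<n}" using n_pos by auto
  then have "to_ac c = x * (\<Prod>i\<in>{0<..<n}. (\<phi> ^^ i) x)" by (simp flip: c)
  then have "inverse x = to_ac (inverse c) * (\<Prod>i\<in>{0<..<n}. (\<phi> ^^ i) x)"
    using False \<open>to_ac c \<noteq> 0\<close> by (simp add: field_simps)
  moreover have "to_ac (inverse c) * (\<Prod>i\<in>{0<..<n}. (\<phi> ^^ i) x) \<in> L"
    using assms by (intro L_mult L_prod L_to_ac) simp
  ultimately show ?thesis by (simp only:)
qed simp

lemma L_divide [simp]: "x \<in> L \<Longrightarrow> y \<in> L \<Longrightarrow> x / y \<in> L"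
  by (simp add: divide_inverse)

lemma iter_inverse: "x \<in> L \<Longrightarrow> (\<phi> ^^ i) (inverse x) = inverse ((\<phi> ^^ i) x)"
proof (cases "x = 0")
  case False
  assume x: "x \<in> L"
  then have "(\<phi> ^^ i) (inverse x) * (\<phi> ^^ i) x = (\<phi> ^^ i) (inverse x * x)"
    by (simp add: iter_mult)
  also have "\<dots> = 1" using False by simp
  finally show ?thesis by (metis inverse_unique mult.commute)
qed simp

lemma iter_divide: "x \<in> L \<Longrightarrow> y \<in> L \<Longrightarrow> (\<phi> ^^ i) (x / y) = (\<phi> ^^ i) x / (\<phi> ^^ i) y"
  by (simp add: divide_inverse iter_mult iter_inverse)

lemmas \<phi>_inverse = iter_inverse[of _ 1, simplified]
  and \<phi>_divide = iter_divide[of _ _ 1, simplified]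

lemma coeff_root_product:
  fixes m :: nat
  assumes "\<And>i. i < m \<Longrightarrow> r i \<in> L"
  shows "coeff (\<Prod>i<m. [:- r i, 1:]) j \<in> L \<and>
    \<phi> (coeff (\<Prod>i<m. [:- r i, 1:]) j) = coeff (\<Prod>i<m. [:- \<phi> (r i), 1:]) j"
  using assms
proof (induction m arbitrary: j)
  case 0
  show ?case by (auto simp: coeff_1 \<phi>_1 \<phi>_0)
next
  case (Suc m)
  have step: "coeff (q * [:- s, 1:]) j = - s * coeff q j + (if j = 0 then 0 else coeff q (j - 1))"
    for q :: "'k alg_closure poly" and s j by (simp add: mult.commute[of q] mult_pCons_left coeff_pCons split: nat.splits)
  show ?case
    using Suc.IH[of j] Suc.IH[of "j - 1"] Suc.prems
    unfolding prod.lessThan_Suc step by (simp add: \<phi>_0 \<phi>_add \<phi>_mult \<phi>_minus \<phi>_diff less_Suc_eq)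
qed

text \<open>The minimal polynomial of the primitive element: a product over conjugates has coefficients
  in the fixed field.\<close>

lemma minimal_polynomial:
  obtains h :: "'k poly" where "degree h = n" "lead_coeff h = 1"
    "\<And>y. ev h y = (\<Prod>i<n. y - (\<phi> ^^ i) \<theta>)"
proof -
  define C where "C = (\<Prod>i<n. [:- (\<phi> ^^ i) \<theta>, 1:])"
  have "[:- \<theta>, 1:] * (\<Prod>i<n. [:- (\<phi> ^^ Suc i) \<theta>, 1:]) = (\<Prod>i<Suc n. [:- (\<phi> ^^ i) \<theta>, 1:])"
    by (subst prod.lessThan_Suc_shift) simp
  also have "\<dots> = [:- \<theta>, 1:] * C"
    by (simp add: \<phi>_order C_def mult.commute del: funpow.simps mult_pCons_left mult_pCons_right)
  finally have shift: "(\<Prod>i<n. [:- \<phi> ((\<phi> ^^ i) \<theta>), 1:]) = C"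
    by (subst (asm) mult_cancel_left) auto
  have coeff_C: "coeff C j \<in> range to_ac" for j
    using coeff_root_product[of n "\<lambda>i. (\<phi> ^^ i) \<theta>" j] unfolding shift C_def[symmetric]
    by (intro fixed_field) auto
  have degC: "degree C = n" and leadC: "lead_coeff C = 1"
    unfolding C_def lead_coeff_prod by (simp_all add: degree_prod_eq_sum_degree)
  define h where "h = map_poly of_ac C"
  have hC: "map_poly to_ac h = C"
    using coeff_C by (intro poly_eqI) (simp add: h_def coeff_map_poly to_ac_of_ac)
  have "degree h = n" using degree_map_poly[of to_ac h] degC by (simp add: hC)
  moreover have "lead_coeff h = 1"
    using leadC calculation degC by (simp add: h_def coeff_map_poly)
  moreover have "ev h y = (\<Prod>i<n. y - (\<phi> ^^ i) \<theta>)" for y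
    by (simp add: ev_def hC C_def poly_prod)
  ultimately show ?thesis using that by blast
qed

lemma degree_lt_unique:
  assumes "ev q \<theta> = 0" "\<forall>i\<ge>n. coeff q i = 0"
  shows "q = 0"
proof (rule ccontr)
  assume q: "q \<noteq> 0"
  have "(\<phi> ^^ i) \<theta> \<in> {y. ev q y = 0}" for i
    using iter_ev[of \<theta> i q] assms(1) by simp
  then have "card ((\<lambda>i. (\<phi> ^^ i) \<theta>) ` {..<n}) \<le> card {y. ev q y = 0}"
    by (intro card_mono ev_root_finite q) auto
  also have "\<dots> \<le> degree q" by (rule ev_root_finite[OF q])
  finally have "n \<le> degree q" using conjugates by (simp add: card_image)
  then have "lead_coeff q = 0" using assms(2) by simp
  then show False using q by simp
qed

lemma inj_powers: "inj_on (\<lambda>i. \<theta> ^ i) {..<n}"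
proof (rule inj_onI)
  fix i j assume ij: "i \<in> {..<n}" "j \<in> {..<n}" "\<theta> ^ i = \<theta> ^ j"
  then have "monom 1 i - monom 1 j = (0 :: 'k poly)" by (intro degree_lt_unique) auto
  then show "i = j" by (metis eq_iff_diff_eq_0 monom_eq_iff' zero_neq_one)
qed

lemma basis:
  "ac.independent ((\<lambda>i. \<theta> ^ i) ` {..<n})" "ac.span ((\<lambda>i. \<theta> ^ i) ` {..<n}) = L"
  "card ((\<lambda>i. \<theta> ^ i) ` {..<n}) = n"
proof -
  let ?B = "(\<lambda>i. \<theta> ^ i) ` {..<n}"
  show "card ?B = n" using inj_powers by (simp add: card_image)
  show "ac.independent ?B"
  proof (rule ac.independent_if_scalars_zero)
    fix f x assume sum: "(\<Sum>x\<in>?B. to_ac (f x) * x) = 0" and "x \<in> ?B"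
    then obtain i where i: "i < n" "x = \<theta> ^ i" by auto
    define q where "q = (\<Sum>j<n. monom (f (\<theta> ^ j)) j)"
    have "ev q \<theta> = 0"
      using sum by (simp add: q_def ev_sum sum.reindex[OF inj_powers])
    then have "q = 0" by (rule degree_lt_unique) (simp add: q_def coeff_sum)
    then have "coeff q i = 0" by simp
    then show "f x = 0" using i by (simp add: q_def coeff_sum)
  qed simp
  show "ac.span ?B = L"
  proof
    show "ac.span ?B \<subseteq> L"
      by (rule ac.span_minimal) (auto simp: ac.subspace_def)
    show "L \<subseteq> ac.span ?B"
    proof
      fix x assume "x \<in> L"
      then obtain q where q: "x = ev q \<theta>" by (rule L_E)
      obtain h where h: "degree h = n" "lead_coeff h = 1" "ev h \<theta> = 0"
      proof (rule minimal_polynomial)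
        fix h assume h: "degree h = n" "lead_coeff h = 1" "\<And>y. ev h y = (\<Prod>i<n. y - (\<phi> ^^ i) \<theta>)"
        have "ev h \<theta> = 0" unfolding h(3) using n_pos by (auto intro!: prod_zero bexI[of _ 0])
        then show thesis using that h by blast
      qed
      define r where "r = q mod h"
      have "h \<noteq> 0" using h by auto
      then have deg: "degree r < n \<or> r = 0" using degree_mod_less[of h q] h by (auto simp: r_def)
      have "ev (q div h * h + q mod h) \<theta> = ev r \<theta>" unfolding ev_add ev_mult h(3) r_def by simp
      then have "x = ev r \<theta>" by (simp add: q)
      also have "r = (\<Sum>i<n. monom (coeff r i) i)"
        using deg by (auto intro!: poly_eqI coeff_eq_0 simp: coeff_sum)
      also have "ev \<dots> \<theta> = (\<Sum>i<n. to_ac (coeff r i) * \<theta> ^ i)" by (simp add: ev_sum)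
      also have "\<dots> \<in> ac.span ?B"
        by (intro ac.span_sum ac.span_scale ac.span_base) auto
      finally show "x \<in> ac.span ?B" .
    qed
  qed
qed

lemma dim_L: "ac.dim L = n"
  using ac.dim_span_eq_card_independent[OF basis(1)] by (simp add: basis)

definition \<sigma> :: "nat \<Rightarrow> 'k alg_closure \<Rightarrow> 'k alg_closure" where
  "\<sigma> i = restrict (\<phi> ^^ i) L"

text \<open>An automorphism is determined by the image of \<open>\<theta>\<close>, which is a root of the minimal polynomial
  and therefore one of the conjugates.\<close>

lemma carrier_gal_group: "carrier (gal_group L) = \<sigma> ` {..<n}"
proof
  show "\<sigma> ` {..<n} \<subseteq> carrier (gal_group L)"
  proof clarify
    fix i
    have "bij_betw (\<sigma> i) L L"
      using bij_funpow[of i] by (simp add: \<sigma>_def cong: bij_betw_cong)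
    then show "\<sigma> i \<in> carrier (gal_group L)"
      by (auto simp: gal_group_def Bij_def \<sigma>_def iter_add iter_mult)
  qed
  show "carrier (gal_group L) \<subseteq> \<sigma> ` {..<n}"
  proof
    fix \<tau> assume "\<tau> \<in> carrier (gal_group L)"
    then have ext: "\<tau> \<in> extensional L"
      and add: "\<And>x y. x \<in> L \<Longrightarrow> y \<in> L \<Longrightarrow> \<tau> (x + y) = \<tau> x + \<tau> y"
      and mult: "\<And>x y. x \<in> L \<Longrightarrow> y \<in> L \<Longrightarrow> \<tau> (x * y) = \<tau> x * \<tau> y"
      and const: "\<And>c. \<tau> (to_ac c) = to_ac c"
      by (auto simp: gal_group_def Bij_def)
    have zero: "\<tau> 0 = 0" using const[of 0] by simp
    have ev: "\<tau> (ev q \<theta>) = ev q (\<tau> \<theta>)" for q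
      by (induction q) (simp_all add: zero add mult const)
    obtain h where h: "\<And>y. ev h y = (\<Prod>i<n. y - (\<phi> ^^ i) \<theta>)"
      using minimal_polynomial by metis
    have "ev h \<theta> = 0" unfolding h using n_pos by (auto intro!: prod_zero bexI[of _ 0])
    then have "ev h (\<tau> \<theta>) = 0" using ev[of h] zero by simp
    then obtain i where i: "i < n" "\<tau> \<theta> = (\<phi> ^^ i) \<theta>" unfolding h by auto
    have "\<tau> = \<sigma> i"
    proof (rule extensionalityI[OF ext])
      fix x assume "x \<in> L"
      then obtain q where "x = ev q \<theta>" by (rule L_E)
      then show "\<tau> x = \<sigma> i x" using iter_ev[of \<theta> i q] by (simp add: ev i \<sigma>_def)
    qed (simp add: \<sigma>_def)
    then show "\<tau> \<in> \<sigma> ` {..<n}" using i by blast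
  qed
qed

lemma inj_\<sigma>: "inj_on \<sigma> {..<n}"
proof (rule inj_onI)
  fix i j assume "i \<in> {..<n}" "j \<in> {..<n}" "\<sigma> i = \<sigma> j"
  then show "i = j" using conjugates
    by (auto simp: \<sigma>_def inj_on_def dest: fun_cong[of _ _ \<theta>])
qed

lemma \<sigma>_mod: "\<sigma> (i mod n) = \<sigma> i"
  by (auto simp: \<sigma>_def iter_mod intro!: restrict_ext)

lemma \<sigma>_carrier: "\<sigma> i \<in> carrier (gal_group L)"
  using n_pos \<sigma>_mod[of i] by (auto simp: carrier_gal_group intro!: image_eqI[of _ _ "i mod n"])

lemma \<sigma>_mult: "\<sigma> i \<otimes>\<^bsub>gal_group L\<^esub> \<sigma> j = \<sigma> (i + j)"
proof -
  have "\<sigma> i \<in> Bij L" for i using \<sigma>_carrier[of i] by (simp add: gal_group_def)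
  then have "\<sigma> i \<otimes>\<^bsub>gal_group L\<^esub> \<sigma> j = compose L (\<sigma> i) (\<sigma> j)"
    by (simp add: gal_group_def BijGroup_def)
  also have "\<dots> = \<sigma> (i + j)"
    by (auto simp: \<sigma>_def compose_def funpow_add intro!: restrict_ext)
  finally show ?thesis .
qed

lemma \<sigma>_one: "\<one>\<^bsub>gal_group L\<^esub> = \<sigma> 0"
  by (auto simp: gal_group_def BijGroup_def \<sigma>_def intro!: restrict_ext)

lemma group_gal_group: "group (gal_group L)"
proof (rule groupI)
  fix x assume "x \<in> carrier (gal_group L)"
  then obtain i where i: "i < n" "x = \<sigma> i" by (auto simp: carrier_gal_group)
  have "\<sigma> (n - i + i) = \<sigma> 0" using i \<sigma>_mod[of n] by simp
  then show "\<exists>y\<in>carrier (gal_group L). y \<otimes>\<^bsub>gal_group L\<^esub> x = \<one>\<^bsub>gal_group L\<^esub>"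
    by (intro bexI[of _ "\<sigma> (n - i)"]) (simp_all only: i \<sigma>_mult \<sigma>_one \<sigma>_carrier)
qed (auto simp: carrier_gal_group[THEN eqset_imp_iff] \<sigma>_mult \<sigma>_one add.assoc
       intro: \<sigma>_carrier[unfolded carrier_gal_group])

lemma gal_group_generated: "carrier (gal_group L) = generate (gal_group L) {\<sigma> 1}"
proof
  interpret G: group "gal_group L" by (rule group_gal_group)
  show "generate (gal_group L) {\<sigma> 1} \<subseteq> carrier (gal_group L)"
    by (rule G.generate_incl) (use \<sigma>_carrier in auto)
  have "\<sigma> i \<in> generate (gal_group L) {\<sigma> 1}" for i
  proof (induction i)
    case 0
    show ?case using generate.one[of "gal_group L"] by (simp add: \<sigma>_one)
  next
    case (Suc i)
    then have "\<sigma> 1 \<otimes>\<^bsub>gal_group L\<^esub> \<sigma> i \<in> generate (gal_group L) {\<sigma> 1}"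
      by (intro generate.eng[OF generate.incl]) auto
    then show ?case by (simp add: \<sigma>_mult)
  qed
  then show "carrier (gal_group L) \<subseteq> generate (gal_group L) {\<sigma> 1}"
    by (auto simp: carrier_gal_group)
qed

lemma subfield_L: "subfield L ring_of_type_algebra"
proof -
  let ?R = "ring_of_type_algebra :: 'k alg_closure ring"
  interpret R: field ?R by (rule field_from_type_algebra)
  have minus: "\<ominus>\<^bsub>?R\<^esub> x = - x" for x
    by (rule R.minus_equality) (auto simp: ring_of_type_algebra_def)
  have inv: "inv\<^bsub>?R\<^esub> x = inverse x" if "x \<noteq> 0" for x
    by (rule R.inv_char) (use that in \<open>auto simp: ring_of_type_algebra_def\<close>)
  show ?thesis
  proof (rule R.subfieldI')
    show "subring L ?R"
    proof (rule R.subringI)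
      fix x assume "x \<in> L"
      then show "\<ominus>\<^bsub>?R\<^esub> x \<in> L" by (simp add: minus)
    qed (auto simp: ring_of_type_algebra_def)
    fix x assume "x \<in> L - {\<zero>\<^bsub>?R\<^esub>}"
    then show "inv\<^bsub>?R\<^esub> x \<in> L" by (auto simp: inv ring_of_type_algebra_def[THEN arg_cong[of _ _ ring.zero]])
  qed
qed

lemma finite_galois: "finite_galois_extension L"
  unfolding finite_galois_extension_def
proof (intro conjI)
  show "\<exists>B. finite B \<and> ac.span B = L" using basis(2) by blast
  show "{x \<in> L. \<forall>\<theta>\<in>carrier (gal_group L). \<theta> x = x} = range to_ac"
  proof
    show "{x \<in> L. \<forall>\<theta>\<in>carrier (gal_group L). \<theta> x = x} \<subseteq> range to_ac"
      using \<sigma>_carrier[of 1] by (auto simp: \<sigma>_def intro!: fixed_field)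
    show "range to_ac \<subseteq> {x \<in> L. \<forall>\<theta>\<in>carrier (gal_group L). \<theta> x = x}"
      by (auto simp: carrier_gal_group \<sigma>_def)
  qed
qed (auto simp: subfield_L)

lemma gal_trace: "x \<in> L \<Longrightarrow> to_ac (gal_trace L x) = (\<Sum>i<n. (\<phi> ^^ i) x)"
  using trace_in_base[of x] unfolding gal_trace_def carrier_gal_group sum.reindex[OF inj_\<sigma>]
  by (simp add: \<sigma>_def to_ac_of_ac)

end

text \<open>The exponents \<open>p ^ i\<close> with \<open>i < n\<close> are distinct modulo \<open>N = p ^ n - 1\<close>, and
  \<open>p ^ n\<close> is congruent to \<open>1\<close>, so \<open>\<phi>\<close> has order \<open>n\<close>.\<close>

sublocale unramified \<subseteq> cyclic_extension L \<phi> n \<omega>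
proof
  have pow: "(\<phi> ^^ i) \<omega> = \<omega> ^ (p ^ i)" for i
  proof (induction i)
    case (Suc i)
    have "\<phi> (\<omega> ^ m) = \<phi> \<omega> ^ m" for m
      using \<phi>_to_ac[of 1] by (induction m) (simp_all add: \<phi>_mult L_power)
    then show ?case using Suc by (simp add: mult.commute flip: power_mult)
  qed simp
  show "inj_on (\<lambda>i. (\<phi> ^^ i) \<omega>) {..<n}"
  proof (rule linorder_inj_onI)
    fix i j assume ij: "i < j" "i \<in> {..<n}" "j \<in> {..<n}"
    show "(\<phi> ^^ i) \<omega> \<noteq> (\<phi> ^^ j) \<omega>"
    proof
      assume "(\<phi> ^^ i) \<omega> = (\<phi> ^^ j) \<omega>"
      then have eq: "\<omega> ^ (p ^ i) = \<omega> ^ (p ^ j)" by (simp only: pow)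
      have lt: "p ^ i < p ^ j" using ij p_gt_1 by simp
      then have "\<omega> ^ (p ^ j) = \<omega> ^ (p ^ i) * \<omega> ^ (p ^ j - p ^ i)" by (simp flip: power_add)
      then have "\<omega> ^ (p ^ j - p ^ i) = 1" using eq by simp
      then have "N dvd p ^ j - p ^ i" by (simp only: \<omega>_power_eq_1_iff)
      then have "N \<le> p ^ j - p ^ i" using lt by (intro dvd_imp_le) auto
      moreover have "p ^ j < p ^ n" using ij p_gt_1 by simp
      moreover have "p ^ i \<ge> 1" using p_gt_1 by simp
      ultimately show False using lt unfolding N_def by linarith
    qed
  qed auto
  show "(\<phi> ^^ n) x = x" if x: "x \<in> L" for x
  proof -
    have "(\<phi> ^^ n) (ev q \<omega>) = ev q ((\<phi> ^^ n) \<omega>)" for q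
    proof -
      have "(\<phi> ^^ i) (ev q \<omega>) = ev q (\<omega> ^ (p ^ i)) " for i
      proof (induction i arbitrary: q)
        case (Suc i)
        have comp: "ev (pcompose q (monom 1 p)) y = ev q (y ^ p)" for y
          by (induction q) (simp_all add: pcompose_pCons)
        have "(\<phi> ^^ Suc i) (ev q \<omega>) = (\<phi> ^^ i) (ev (pcompose q (monom 1 p)) \<omega>)"
          by (simp add: funpow_swap1 \<phi>_ev comp)
        also have "\<dots> = ev q ((\<omega> ^ (p ^ i)) ^ p)" unfolding Suc by (rule comp)
        also have "(\<omega> ^ (p ^ i)) ^ p = \<omega> ^ (p ^ Suc i)"
          by (simp add: mult.commute flip: power_mult)
        finally show ?case .
      qed simp
      then show ?thesis by (simp add: pow)
    qed
    moreover have "\<omega> ^ (p ^ n) = \<omega> * \<omega> ^ N"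
    proof -
      have "p ^ n = Suc N" using p_gt_1 by (simp add: N_def)
      then show ?thesis by simp
    qed
    ultimately show ?thesis using x by (auto elim!: L_E simp: pow)
  qed
qed (rule n_pos L_def \<phi>_L \<phi>_add \<phi>_mult \<phi>_to_ac fixed_field; assumption)+

section \<open>Dimensions and direct sums\<close>

lemma (in vector_space) dim_direct_sum:
  assumes S: "subspace S" and T: "subspace T" and disjoint: "S \<inter> T \<subseteq> {0}"
    and fin: "finite W" "S \<subseteq> span W" "T \<subseteq> span W"
  shows "dim {x + y | x y. x \<in> S \<and> y \<in> T} = dim S + dim T"
proof -
  obtain B where B: "B \<subseteq> S" "independent B" "S \<subseteq> span B" "card B = dim S" by (rule basis_exists)
  obtain C where C: "C \<subseteq> T" "independent C" "T \<subseteq> span C" "card C = dim T" by (rule basis_exists)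
  have finB: "finite B" and finC: "finite C"
    using independent_span_bound[OF fin(1) B(2)] independent_span_bound[OF fin(1) C(2)] B(1) C(1) fin
    by auto
  have spanB: "span B = S" and spanC: "span C = T"
    using B C S T by (simp_all add: span_subspace)
  have BC: "B \<inter> C = {}"
  proof -
    have "0 \<notin> B" using B(2) dependent_zero by blast
    then show ?thesis using B(1) C(1) disjoint by auto
  qed
  have "independent (B \<union> C)"
  proof (rule independent_if_scalars_zero)
    fix f x assume eq: "(\<Sum>x\<in>B \<union> C. scale (f x) x) = 0" and x: "x \<in> B \<union> C"
    have eq': "(\<Sum>x\<in>B. scale (f x) x) + (\<Sum>x\<in>C. scale (f x) x) = 0"
      using eq sum.union_disjoint[OF finB finC BC, of "\<lambda>x. scale (f x) x"] by simp
    have inS: "(\<Sum>x\<in>B. scale (f x) x) \<in> S"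
      using B(1) S by (intro subspace_sum subspace_scale) auto
    have "(\<Sum>x\<in>C. scale (f x) x) \<in> T"
      using C(1) T by (intro subspace_sum subspace_scale) auto
    then have "- (\<Sum>x\<in>C. scale (f x) x) \<in> T" using T by (rule subspace_neg[rotated])
    then have "(\<Sum>x\<in>B. scale (f x) x) \<in> T" using eq' by (simp only: eq_neg_iff_add_eq_0[symmetric])
    then have zB: "(\<Sum>x\<in>B. scale (f x) x) = 0" using inS disjoint by blast
    then have zC: "(\<Sum>x\<in>C. scale (f x) x) = 0" using eq' by simp
    show "f x = 0"
      using x independentD[OF B(2) finB order_refl zB] independentD[OF C(2) finC order_refl zC] by blast
  qed (simp add: finB finC)
  moreover have "span (B \<union> C) = {x + y | x y. x \<in> S \<and> y \<in> T}"
    by (simp add: span_Un spanB spanC)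
  ultimately have "dim {x + y | x y. x \<in> S \<and> y \<in> T} = card (B \<union> C)"
    by (metis dim_span_eq_card_independent)
  then show ?thesis using B(4) C(4) by (simp add: card_Un_disjoint finB finC BC)
qed

lemma (in vector_space_pair) dim_injective_image:
  assumes f: "Vector_Spaces.linear s1 s2 f" and inj: "inj_on f (vs1.span S)"
  shows "vs2.dim (f ` S) = vs1.dim S"
proof -
  obtain B where B: "B \<subseteq> S" "vs1.independent B" "S \<subseteq> vs1.span B" "card B = vs1.dim S"
    by (rule vs1.basis_exists)
  have span: "vs1.span B = vs1.span S"
    using B(1,3) vs1.span_mono vs1.span_minimal by (metis vs1.subspace_span subset_antisym)
  have "vs2.independent (f ` B)"
    using linear_independent_injective_image[OF f B(2)] inj by (simp add: span)
  then have "vs2.dim (f ` S) = card (f ` B)"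
    by (intro vs2.dim_eq_card) (simp_all add: linear_span_image[OF f] span)
  also have "\<dots> = card B"
    using inj B(1) vs1.span_superset by (intro card_image) (blast intro: inj_on_subset)
  finally show ?thesis using B(4) by simp
qed

lemma is_direct_sum_empty: "is_direct_sum {0} {} W"
  by (simp add: is_direct_sum_def bij_betw_def)

text \<open>Direct sums are built up one summand at a time, following a chain of subfields.\<close>

lemma is_direct_sum_insert:
  fixes A C :: "'a :: comm_monoid_add set"
  assumes A: "is_direct_sum A I W" and I: "finite I" "i \<notin> I"
    and C: "bij_betw (\<lambda>(x, y). x + y) (A \<times> W i) C"
  shows "is_direct_sum C (insert i I) W"
proof -
  define r where "r w = ((\<Sum>j\<in>I. w j), w i :: 'a)" for w
  have bA: "bij_betw (\<lambda>w. \<Sum>j\<in>I. w j) (PiE I W) A" using A by (simp add: is_direct_sum_def)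
  have "bij_betw r (PiE (insert i I) W) (A \<times> W i)"
    unfolding bij_betw_def
  proof
    show "inj_on r (PiE (insert i I) W)"
    proof (rule inj_onI)
      fix w w' assume w: "w \<in> PiE (insert i I) W" "w' \<in> PiE (insert i I) W" and "r w = r w'"
      then have eq: "(\<Sum>j\<in>I. w j) = (\<Sum>j\<in>I. w' j)" "w i = w' i" by (auto simp: r_def)
      have "restrict w I = restrict w' I"
        using bA w eq(1) unfolding bij_betw_def inj_on_def
        by (auto dest!: bspec[of _ _ "restrict w I"] bspec[of _ _ "restrict w' I"] simp: PiE_def Pi_def)
      then have "w j = w' j" if "j \<in> I" for j using that by (metis restrict_apply')
      then show "w = w'" using w eq(2) by (intro PiE_ext) auto
    qed
    show "r ` PiE (insert i I) W = A \<times> W i"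
    proof (intro equalityI subsetI)
      fix z assume "z \<in> r ` PiE (insert i I) W"
      then obtain w where w: "w \<in> PiE (insert i I) W" "z = r w" by blast
      have "restrict w I \<in> PiE I W" using w(1) by (auto simp: PiE_def Pi_def)
      then have "(\<Sum>j\<in>I. w j) \<in> A" using bspec[OF bij_betwE[OF bA], of "restrict w I"] by simp
      then show "z \<in> A \<times> W i" using w by (auto simp: r_def PiE_def Pi_def)
    next
      fix z assume "z \<in> A \<times> W i"
      then obtain x y where z: "z = (x, y)" "x \<in> A" "y \<in> W i" by blast
      then obtain w where w: "w \<in> PiE I W" "(\<Sum>j\<in>I. w j) = x" using bA by (auto simp: bij_betw_def)
      have "(\<Sum>j\<in>I. (w(i := y)) j) = (\<Sum>j\<in>I. w j)" using I by (intro sum.cong) auto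
      then have "z = r (w(i := y))" using z w by (simp add: r_def)
      moreover have "w(i := y) \<in> PiE (insert i I) W" using w z by (intro PiE_fun_upd) auto
      ultimately show "z \<in> r ` PiE (insert i I) W" by blast
    qed
  qed
  then have "bij_betw ((\<lambda>(x, y). x + y) \<circ> r) (PiE (insert i I) W) C"
    using C by (rule bij_betw_trans)
  moreover have "(\<lambda>(x, y). x + y) \<circ> r = (\<lambda>w. \<Sum>j\<in>insert i I. w j)"
    using I by (auto simp: r_def fun_eq_iff add.commute)
  ultimately show ?thesis by (simp add: is_direct_sum_def)
qed

lemma is_direct_sum_image:
  assumes A: "is_direct_sum A I W" and sub: "\<And>i. i \<in> I \<Longrightarrow> W i \<subseteq> A"
    and inj: "inj_on T A"
    and sum: "\<And>w. (\<And>i. i \<in> I \<Longrightarrow> w i \<in> A) \<Longrightarrow> T (\<Sum>i\<in>I. w i) = (\<Sum>i\<in>I. T (w i))"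
  shows "is_direct_sum (T ` A) I (\<lambda>i. T ` W i)"
proof -
  define m where "m w = restrict (\<lambda>i. T (w i)) I" for w
  have inj_W: "T x = T y \<longleftrightarrow> x = y" if "i \<in> I" "x \<in> W i" "y \<in> W i" for i x y
    using inj sub that by (auto simp: inj_on_def)
  have m: "bij_betw m (PiE I W) (PiE I (\<lambda>i. T ` W i))"
    unfolding bij_betw_def
  proof
    show "inj_on m (PiE I W)"
    proof (rule inj_onI)
      fix w w' assume w: "w \<in> PiE I W" "w' \<in> PiE I W" and "m w = m w'"
      then have "T (w i) = T (w' i)" if "i \<in> I" for i
        using that by (auto simp: m_def dest: fun_cong[of _ _ i])
      then have "w i = w' i" if "i \<in> I" for i
        using that w inj_W[of i "w i" "w' i"] by (auto simp: PiE_def Pi_def)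
      then show "w = w'" using w by (intro PiE_ext)
    qed
    show "m ` PiE I W = PiE I (\<lambda>i. T ` W i)"
    proof (intro equalityI subsetI)
      fix u assume u: "u \<in> PiE I (\<lambda>i. T ` W i)"
      then have "\<forall>i\<in>I. \<exists>x\<in>W i. u i = T x" by (auto simp: PiE_def Pi_def)
      then obtain w where w: "\<And>i. i \<in> I \<Longrightarrow> w i \<in> W i \<and> u i = T (w i)" by metis
      have "u = m (restrict w I)"
        using w by (intro PiE_ext[OF u]) (auto simp: m_def)
      then show "u \<in> m ` PiE I W" using w by auto
    qed (auto simp: m_def)
  qed
  have "bij_betw (\<lambda>w. \<Sum>i\<in>I. w i) (PiE I W) A" using A by (simp add: is_direct_sum_def)
  then have "bij_betw (T \<circ> (\<lambda>w. \<Sum>i\<in>I. w i)) (PiE I W) (T ` A)"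
    using inj by (intro bij_betw_trans) (auto simp: bij_betw_def)
  moreover have "(T \<circ> (\<lambda>w. \<Sum>i\<in>I. w i)) w = ((\<lambda>u. \<Sum>i\<in>I. u i) \<circ> m) w" if "w \<in> PiE I W" for w
  proof -
    have "T (\<Sum>i\<in>I. w i) = (\<Sum>i\<in>I. T (w i))"
      using that sub by (intro sum) (auto simp: PiE_def Pi_def)
    then show ?thesis by (simp add: m_def)
  qed
  ultimately have "bij_betw ((\<lambda>u. \<Sum>i\<in>I. u i) \<circ> m) (PiE I W) (T ` A)"
    by (simp cong: bij_betw_cong)
  then show ?thesis
    using bij_betw_comp_iff[OF m, of "\<lambda>u. \<Sum>i\<in>I. u i" "T ` A"] by (simp add: is_direct_sum_def)
qed

global_interpretation ac_form: vector_space_pair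
  "\<lambda>(c :: 'k :: field) (x :: 'k alg_closure). to_ac c * x" "form_scale :: 'k \<Rightarrow> 'k form \<Rightarrow> 'k form" ..

global_interpretation ac_ac: vector_space_pair
  "\<lambda>(c :: 'k :: field) (x :: 'k alg_closure). to_ac c * x"
  "\<lambda>(c :: 'k :: field) (x :: 'k alg_closure). to_ac c * x" ..

lemma linear_multiple:
  "Vector_Spaces.linear (\<lambda>(c :: 'k :: field) (x :: 'k alg_closure). to_ac c * x)
     (\<lambda>c x. to_ac c * x) ((*) b)"
  unfolding Vector_Spaces.linear_iff
  by (auto intro: ac.vector_space_axioms simp: distrib_left mult.left_commute)

lemma dim_multiple:
  fixes c :: "'k :: field alg_closure"
  assumes "c \<noteq> 0"
  shows "ac.dim ((*) c ` S) = ac.dim S"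
  using assms by (intro ac_ac.dim_injective_image linear_multiple inj_onI) simp

lemma subspace_multiple:
  fixes c :: "'k :: field alg_closure"
  assumes "ac.subspace S"
  shows "ac.subspace ((*) c ` S)"
  using ac_ac.linear_subspace_image[OF linear_multiple assms] .

section \<open>Fixed fields of powers of the generator\<close>

context cyclic_extension
begin

lemma subset_L_span: "S \<subseteq> L \<Longrightarrow> S \<subseteq> ac.span ((\<lambda>i. \<theta> ^ i) ` {..<n})"
  by (simp add: basis(2))

definition Fix :: "nat \<Rightarrow> 'k alg_closure set" where
  "Fix m = {x \<in> L. (\<phi> ^^ m) x = x}"

lemma Fix_L: "Fix m \<subseteq> L" by (auto simp: Fix_def)

lemma subspace_Fix: "ac.subspace (Fix m)"
  by (auto simp: Fix_def ac.subspace_def iter_add iter_mult)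

lemma Fix_n: "Fix n = L"
  by (auto simp: Fix_def \<phi>_order)

lemma Fix_1: "Fix 1 = range to_ac"
  using fixed_field by (auto simp: Fix_def)

lemma dim_Fix_1: "ac.dim (Fix 1) = 1"
proof -
  have "ac.span {1} = Fix 1"
    unfolding Fix_1 by (auto simp: ac.span_singleton)
  moreover have "ac.independent {1 :: 'k alg_closure}" by (simp add: ac.dependent_single)
  ultimately have "ac.dim (Fix 1) = card {1 :: 'k alg_closure}"
    using ac.dim_span_eq_card_independent by metis
  then show ?thesis by simp
qed

text \<open>An element \<open>c\<close> negated by \<open>\<phi> ^^ m\<close> splits the fixed field of \<open>\<phi> ^^ (2 * m)\<close> into the
  eigenspaces of the involution \<open>\<phi> ^^ m\<close>.\<close>

lemma Fix_double:
  assumes c: "c \<in> L" "c \<noteq> 0" "(\<phi> ^^ m) c = - c"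
  shows "bij_betw (\<lambda>(x, y). x + y) (Fix m \<times> (*) c ` Fix m) (Fix (2 * m))"
  unfolding bij_betw_def
proof
  have neg: "(\<phi> ^^ m) y = - y" if "y \<in> (*) c ` Fix m" for y
    using that c by (auto simp: Fix_def iter_mult)
  have inL: "y \<in> L" if "y \<in> (*) c ` Fix m" for y
    using that c by (auto simp: Fix_def)
  show "inj_on (\<lambda>(x, y). x + y) (Fix m \<times> (*) c ` Fix m)"
  proof (rule inj_onI; unfold case_prod_beta)
    fix s t assume "s \<in> Fix m \<times> (*) c ` Fix m" "t \<in> Fix m \<times> (*) c ` Fix m"
      and eq0: "fst s + snd s = fst t + snd t"
    then obtain x y x' y' where st: "s = (x, y)" "t = (x', y')" and x: "x \<in> Fix m" "x' \<in> Fix m" and y: "y \<in> (*) c ` Fix m" "y' \<in> (*) c ` Fix m"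
      by (metis SigmaE)
    have eq: "x + y = x' + y'" using eq0 by (simp add: st)
    have "(\<phi> ^^ m) (x + y) = x - y" "(\<phi> ^^ m) (x' + y') = x' - y'"
      using x inL[OF y(1)] inL[OF y(2)] neg[OF y(1)] neg[OF y(2)] by (simp_all add: iter_add Fix_def)
    then have "x - y = x' - y'" using eq by simp
    have "2 * x = (x + y) + (x - y)" by simp
    also have "\<dots> = 2 * x'" unfolding eq \<open>x - y = x' - y'\<close> by simp
    finally have "x = x'" by simp
    then show "s = t" using eq by (simp add: st)
  qed
  show "(\<lambda>(x, y). x + y) ` (Fix m \<times> (*) c ` Fix m) = Fix (2 * m)"
  proof (intro equalityI subsetI)
    fix z assume "z \<in> (\<lambda>(x, y). x + y) ` (Fix m \<times> (*) c ` Fix m)"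
    then obtain x y where xy: "x \<in> Fix m" "y \<in> (*) c ` Fix m" "z = x + y" by auto
    then have "x \<in> L" "y \<in> L" "(\<phi> ^^ m) x = x" "(\<phi> ^^ m) y = - y"
      using inL[OF xy(2)] neg[OF xy(2)] by (simp_all add: Fix_def)
    then show "z \<in> Fix (2 * m)"
      by (simp add: xy(3) Fix_def mult_2 iter_add iter_diff iter_minus flip: iter_iter)
  next
    fix z assume z: "z \<in> Fix (2 * m)"
    define z' where "z' = (\<phi> ^^ m) z"
    have zL: "z \<in> L" and z'L: "z' \<in> L" and z'': "(\<phi> ^^ m) z' = z"
      using z by (auto simp: Fix_def z'_def mult_2 iter_iter)
    have z': "(\<phi> ^^ m) z = z'" by (simp add: z'_def)
    have two: "2 \<in> L" "(\<phi> ^^ m) 2 = 2"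
      using L_to_ac[of 2] iter_to_ac[of m 2] by simp_all
    define x where "x = (z + z') / 2"
    define y where "y = (z - z') / 2"
    have xL: "x \<in> L" and yL: "y \<in> L" using zL z'L two by (simp_all add: x_def y_def)
    have "(\<phi> ^^ m) x = (z' + z) / 2"
      using zL z'L two by (simp add: x_def iter_divide iter_add z' z'')
    then have "x \<in> Fix m" using xL by (simp add: Fix_def x_def add.commute)
    moreover have "y \<in> (*) c ` Fix m"
    proof
      show "y = c * (y / c)" using c by simp
      have "(\<phi> ^^ m) y = (z' - z) / 2"
        using zL z'L two by (simp add: y_def iter_divide iter_diff z' z'')
      also have "\<dots> = - y" by (simp add: y_def flip: minus_divide_left)
      finally show "y / c \<in> Fix m" using yL c by (simp add: Fix_def iter_divide)
    qed
    moreover have "z = x + y" by (simp add: x_def y_def flip: add_divide_distrib)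
    ultimately show "z \<in> (\<lambda>(x, y). x + y) ` (Fix m \<times> (*) c ` Fix m)" by force
  qed
qed

lemma dim_Fix_double:
  assumes c: "c \<in> L" "c \<noteq> 0" "(\<phi> ^^ m) c = - c"
  shows "ac.dim (Fix (2 * m)) = 2 * ac.dim (Fix m)"
proof -
  have bij: "bij_betw (\<lambda>(x, y). x + y) (Fix m \<times> (*) c ` Fix m) (Fix (2 * m))"
    by (rule Fix_double[OF c])
  have cL: "(*) c ` Fix m \<subseteq> L" using c(1) by (auto simp: Fix_def)
  have zero: "0 \<in> Fix m" by (simp add: Fix_def)
  have zero': "0 \<in> (*) c ` Fix m" by (rule image_eqI[OF _ zero]) simp
  have "Fix m \<inter> (*) c ` Fix m \<subseteq> {0}"
  proof
    fix x assume x: "x \<in> Fix m \<inter> (*) c ` Fix m"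
    then have "(x, 0) = (0, x)" using bij zero zero'
      by (intro inj_onD[OF bij_betw_imp_inj_on[OF bij]]) auto
    then show "x \<in> {0}" by simp
  qed
  moreover have "Fix (2 * m) = {x + y | x y. x \<in> Fix m \<and> y \<in> (*) c ` Fix m}"
    using bij_betw_imp_surj_on[OF bij] by force
  ultimately have "ac.dim (Fix (2 * m)) = ac.dim (Fix m) + ac.dim ((*) c ` Fix m)"
    using ac.dim_direct_sum[OF subspace_Fix[of m] subspace_multiple[OF subspace_Fix[of m], of c],
        of "(\<lambda>i. \<theta> ^ i) ` {..<n}"] subset_L_span[OF Fix_L] subset_L_span[OF cL] by simp
  then show ?thesis using c by (simp add: dim_multiple)
qed

section \<open>Skew forms and their radicals\<close>

definition form :: "'k alg_closure \<Rightarrow> 'k form" where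
  "form = skew_form L (\<sigma> 1)"

lemma form_apply:
  assumes "b \<in> L" "x \<in> L" "y \<in> L"
  shows "to_ac (form b x y) = (\<Sum>i<n. (\<phi> ^^ i) (b * (x * \<phi> y - \<phi> x * y)))"
  using assms by (simp add: form_def skew_form_def \<sigma>_def gal_trace)

lemma form_outside: "x \<notin> L \<or> y \<notin> L \<Longrightarrow> form b x y = 0"
  by (auto simp: form_def skew_form_def)

lemma form_add:
  assumes "b \<in> L" "c \<in> L"
  shows "form (b + c) = form b + form c"
proof (intro ext)
  fix x y
  show "form (b + c) x y = (form b + form c) x y"
  proof (cases "x \<in> L \<and> y \<in> L")
    case True
    then have "to_ac (form (b + c) x y) = to_ac (form b x y) + to_ac (form c x y)"
      using assms by (simp add: form_apply distrib_right iter_add sum.distrib)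
    then show ?thesis by (simp flip: to_ac_add)
  qed (auto simp: form_outside)
qed

lemma form_scale:
  assumes "b \<in> L"
  shows "form (to_ac c * b) = form_scale c (form b)"
proof (intro ext)
  fix x y
  show "form (to_ac c * b) x y = form_scale c (form b) x y"
  proof (cases "x \<in> L \<and> y \<in> L")
    case True
    then have "to_ac (form (to_ac c * b) x y) = to_ac c * to_ac (form b x y)"
      using assms by (simp add: form_apply mult.assoc iter_mult sum_distrib_left)
    then show ?thesis by (simp add: form_scale_def flip: to_ac_mult)
  qed (auto simp: form_outside form_scale_def)
qed

lemma form_0: "form 0 = 0"
  using form_scale[of 0 0] by (simp add: form_scale_def fun_eq_iff)

lemma form_alt: "b \<in> L \<Longrightarrow> form b \<in> alt_forms L"
proof -
  assume b: "b \<in> L"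
  have eqI: "s = t" if "to_ac s = to_ac t" for s t :: 'k using that by simp
  show ?thesis
    unfolding alt_forms_def
  proof (intro CollectI conjI ballI allI)
    fix x y z assume xyz: "x \<in> L" "y \<in> L" "z \<in> L"
    show "form b (x + y) z = form b x z + form b y z"
      using b xyz by (intro eqI)
        (simp add: form_apply \<phi>_add algebra_simps iter_add iter_diff sum.distrib sum_subtractf)
    show "form b z (x + y) = form b z x + form b z y"
      using b xyz by (intro eqI)
        (simp add: form_apply \<phi>_add algebra_simps iter_add iter_diff sum.distrib sum_subtractf)
  next
    fix c x y assume xy: "x \<in> L" "y \<in> L"
    have "b * (to_ac c * x * \<phi> y - \<phi> (to_ac c * x) * y) = to_ac c * (b * (x * \<phi> y - \<phi> x * y))"
      "b * (x * \<phi> (to_ac c * y) - \<phi> x * (to_ac c * y)) = to_ac c * (b * (x * \<phi> y - \<phi> x * y))"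
      using xy by (simp_all add: \<phi>_mult algebra_simps)
    then have "to_ac (form b (to_ac c * x) y) = (\<Sum>i<n. (\<phi> ^^ i) (to_ac c * (b * (x * \<phi> y - \<phi> x * y))))"
      "to_ac (form b x (to_ac c * y)) = (\<Sum>i<n. (\<phi> ^^ i) (to_ac c * (b * (x * \<phi> y - \<phi> x * y))))"
      by (simp_all only: form_apply b xy L_mult L_to_ac)
    moreover have "(\<Sum>i<n. (\<phi> ^^ i) (to_ac c * (b * (x * \<phi> y - \<phi> x * y)))) = to_ac (c * form b x y)"
      using b xy by (simp add: form_apply iter_mult[OF L_to_ac] sum_distrib_left)
    ultimately show "form b (to_ac c * x) y = c * form b x y" "form b x (to_ac c * y) = c * form b x y"
      by (simp_all only: to_ac_eq_iff)
  next
    fix x assume "x \<in> L"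
    then show "form b x x = 0" using b by (intro eqI) (simp add: form_apply mult.commute)
  qed (auto simp: form_outside)
qed

text \<open>Invariance of the trace turns \<open>form b x y\<close> into the trace of
  \<open>(b * x - \<phi> b * \<phi> (\<phi> x)) * \<phi> y\<close>, and the trace form is nondegenerate because \<open>1\<close> has trace
  \<open>n\<close>.\<close>

lemma radical:
  assumes b: "b \<in> L"
  shows "form_radical L (form b) = {x \<in> L. b * x = \<phi> b * \<phi> (\<phi> x)}"
proof -
  have eq: "to_ac (form b x y) = (\<Sum>i<n. (\<phi> ^^ i) ((b * x - \<phi> b * \<phi> (\<phi> x)) * \<phi> y))"
    if "x \<in> L" "y \<in> L" for x y
  proof -
    have "(\<Sum>i<n. (\<phi> ^^ i) (b * \<phi> x * y)) = (\<Sum>i<n. (\<phi> ^^ i) (\<phi> b * \<phi> (\<phi> x) * \<phi> y))"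
      using trace_invariant[of "b * \<phi> x * y"] b that by (simp add: \<phi>_mult)
    then show ?thesis
      using b that by (simp add: form_apply algebra_simps iter_diff sum_subtractf)
  qed
  show ?thesis
    unfolding form_radical_def
  proof (intro Collect_cong conj_cong refl)
    fix x assume x: "x \<in> L"
    define d where "d = b * x - \<phi> b * \<phi> (\<phi> x)"
    have dL: "d \<in> L" using b x by (simp add: d_def)
    have "d = 0" if zero: "\<forall>y\<in>L. form b x y = 0"
    proof (rule ccontr)
      assume "d \<noteq> 0"
      have "inverse d \<in> \<phi> ` L" using bij_\<phi> dL by (simp add: bij_betw_def)
      then obtain y where y: "y \<in> L" "\<phi> y = inverse d" by auto
      have "to_ac (form b x y) = (\<Sum>i<n. (\<phi> ^^ i) (d * inverse d))"
        by (simp add: eq x y flip: d_def)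
      also have "\<dots> = of_nat n" using \<open>d \<noteq> 0\<close> by simp
      finally have "to_ac (form b x y) \<noteq> 0" using n_pos by simp
      then show False using zero y by simp
    qed
    moreover have "\<forall>y\<in>L. form b x y = 0" if "d = 0"
    proof
      fix y assume "y \<in> L"
      then have "to_ac (form b x y) = 0" using eq[of x y] x that by (simp flip: d_def)
      then show "form b x y = 0" by simp
    qed
    ultimately show "(\<forall>y\<in>L. form b x y = 0) \<longleftrightarrow> b * x = \<phi> b * \<phi> (\<phi> x)"
      by (auto simp: d_def)
  qed
qed

lemma rank_nondegenerate:
  assumes "b \<in> L" "\<And>x. x \<in> L \<Longrightarrow> b * x = \<phi> b * \<phi> (\<phi> x) \<Longrightarrow> x = 0"
  shows "form_rank L (form b) = n"
proof -
  have "form_radical L (form b) = {0}"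
    using assms by (auto simp: radical \<phi>_0)
  moreover have "ac.dim {0 :: 'k alg_closure} = 0"
    using ac.dim_span_eq_card_independent[OF ac.independent_empty] by (metis ac.span_empty card.empty)
  ultimately show ?thesis by (simp add: form_rank_def dim_L)
qed

text \<open>A nonzero radical is a line over the fixed field of \<open>\<phi> ^^ 2\<close>, since two of its elements have
  quotient fixed by \<open>\<phi> ^^ 2\<close>.\<close>

lemma rank_degenerate:
  assumes b: "b \<in> L" "b \<noteq> 0" and x: "x \<in> L" "x \<noteq> 0" "b * x = \<phi> b * \<phi> (\<phi> x)"
    and dim: "ac.dim (Fix 2) = 2"
  shows "form_rank L (form b) = n - 2"
proof -
  have "form_radical L (form b) = (*) x ` Fix 2"
    unfolding radical[OF b(1)]
  proof (intro equalityI subsetI)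
    fix y assume "y \<in> {y \<in> L. b * y = \<phi> b * \<phi> (\<phi> y)}"
    then have y: "y \<in> L" "b * y = \<phi> b * \<phi> (\<phi> y)" by auto
    have "\<phi> (\<phi> y) / \<phi> (\<phi> x) = (\<phi> b * \<phi> (\<phi> y)) / (\<phi> b * \<phi> (\<phi> x))"
      using b by simp
    also have "\<dots> = y / x" using b by (simp flip: y(2) x(3))
    finally have "y / x \<in> Fix 2"
      using x y by (simp add: Fix_def numeral_2_eq_2 \<phi>_divide)
    then show "y \<in> (*) x ` Fix 2" using x by (intro image_eqI[of _ _ "y / x"]) auto
  next
    fix y assume "y \<in> (*) x ` Fix 2"
    then obtain z where z: "z \<in> L" "\<phi> (\<phi> z) = z" "y = x * z"
      by (auto simp: Fix_def numeral_2_eq_2)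
    have "b * y = (b * x) * z" by (simp add: z)
    also have "\<dots> = \<phi> b * \<phi> (\<phi> y)" using x z by (simp add: x(3) \<phi>_mult mult.assoc)
    finally show "y \<in> {y \<in> L. b * y = \<phi> b * \<phi> (\<phi> y)}" using x z by simp
  qed
  then show ?thesis by (simp add: form_rank_def dim_L dim_multiple x dim)
qed

text \<open>A form that vanishes identically has radical \<open>L\<close>; testing the radical equation on \<open>1\<close> and on the
  primitive element leaves only \<open>b = 0\<close>, as \<open>\<phi> ^^ 2\<close> is not the identity.\<close>

lemma form_inj:
  assumes "n > 2"
  shows "inj_on form L"
proof (rule inj_onI)
  fix b c assume bc: "b \<in> L" "c \<in> L" "form b = form c"
  define d where "d = b - c"
  have dL: "d \<in> L" using bc by (simp add: d_def)
  have "form b = form d + form c" using form_add[of d c] bc dL by (simp add: d_def)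
  then have "form d = 0" using bc by simp
  then have all: "d * x = \<phi> d * \<phi> (\<phi> x)" if "x \<in> L" for x
    using radical[OF dL] that by (auto simp: form_radical_def)
  have "d = 0"
  proof (rule ccontr)
    assume d: "d \<noteq> 0"
    have "d = \<phi> d" using all[of 1] by (simp add: \<phi>_1)
    then have "(\<phi> ^^ 2) \<theta> = (\<phi> ^^ 0) \<theta>" using all[of \<theta>] d by (simp add: numeral_2_eq_2)
    then have "(2 :: nat) = 0" using assms by (intro inj_onD[OF conjugates]) auto
    then show False by simp
  qed
  then show "b = c" by (simp add: d_def)
qed

lemma form_sum: "(\<And>i. i \<in> I \<Longrightarrow> w i \<in> L) \<Longrightarrow> form (\<Sum>i\<in>I. w i) = (\<Sum>i\<in>I. form (w i))"
  by (induction I rule: infinite_finite_induct) (auto simp: form_0 form_add)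

text \<open>The map \<open>form\<close> is linear only on \<open>L\<close>. There it agrees with the linear extension of its values
  on a basis, and a genuinely linear map that is injective on \<open>L\<close> preserves dimensions.\<close>

lemma form_image:
  assumes n: "n > 2" and S: "ac.subspace S" "S \<subseteq> L"
  shows "form.subspace (form ` S)" "form.dim (form ` S) = ac.dim S"
proof -
  let ?B = "(\<lambda>i. \<theta> ^ i) ` {..<n}"
  obtain g where g: "Vector_Spaces.linear (\<lambda>c x. to_ac c * x) form_scale g" "\<And>x. x \<in> ?B \<Longrightarrow> g x = form x"
    using ac_form.linear_independent_extend[OF basis(1)] by metis
  interpret g: Vector_Spaces.linear "\<lambda>c x. to_ac c * x" form_scale g by (rule g(1))
  have g_eq: "g x = form x" if "x \<in> L" for x
  proof -
    have "g x = form x \<and> x \<in> L" if "x \<in> ac.span ?B" for x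
      using that
    proof (induction rule: ac.span_induct_alt)
      case base
      show ?case by (simp add: g.zero form_0)
    next
      case (step c x y)
      then have "x \<in> L" by auto
      then show ?case using step g(2)[of x] by (simp add: g.add g.scale form_add form_scale)
    qed
    then show ?thesis using that by (simp add: basis(2))
  qed
  have img: "form ` S = g ` S" using g_eq S by (intro image_cong) auto
  have span: "ac.span S = S" using S(1) by simp
  have "inj_on g S" using inj_on_cong[of S g form] inj_on_subset[OF form_inj[OF n] S(2)] g_eq S(2) by blast
  then show "form.dim (form ` S) = ac.dim S"
    unfolding img by (intro ac_form.dim_injective_image g(1)) (simp add: span)
  show "form.subspace (form ` S)"
    unfolding img using ac_form.linear_subspace_image[OF g(1) S(1)] .
qed

end

section \<open>Cyclic extensions with roots of unity of 2-power order\<close>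

lemma prod_shift:
  fixes f :: "nat \<Rightarrow> 'a :: field"
  assumes "f q = f 0" "f 0 \<noteq> 0"
  shows "(\<Prod>t<q. f (Suc t)) = (\<Prod>t<q. f t)"
proof -
  have "f 0 * (\<Prod>t<q. f (Suc t)) = (\<Prod>t<Suc q. f t)" by (rule prod.lessThan_Suc_shift[symmetric])
  then show ?thesis using assms by simp
qed

lemma prod_periodic:
  fixes f :: "nat \<Rightarrow> 'a :: comm_monoid_mult"
  assumes period: "\<And>t. f (q + t) = f t"
  shows "(\<Prod>t<r * q. f t) = (\<Prod>t<q. f t) ^ r"
proof (induction r)
  case (Suc r)
  have "(\<Prod>t<q + m. f t) = (\<Prod>t<q. f t) * (\<Prod>t<m. f t)" for m
    by (induction m) (simp_all add: period mult.assoc)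
  then show ?case using Suc by simp
qed simp

locale two_adic =
  fixes p a l :: nat
  assumes pa: "p + 1 = 2 ^ a * l" and odd_l: "odd l" and a2: "a \<ge> 2"
begin

text \<open>Induction in steps of two, using \<open>p ^ (k + 2) + 1 = p ^ 2 * (p ^ k + 1) - (p ^ 2 - 1)\<close>, where
  \<open>p ^ 2 - 1\<close> is divisible by \<open>2 ^ (a + 1)\<close>.\<close>

lemma odd_power_plus_1:
  assumes "odd k"
  shows "\<exists>t :: int. odd t \<and> int p ^ k = 2 ^ a * t - 1"
proof -
  obtain m where k: "k = 2 * m + 1" using assms by (elim oddE)
  have p: "int p = 2 ^ a * int l - 1"
    using arg_cong[OF pa, of int] by (simp add: of_nat_mult)
  have "\<exists>t :: int. odd t \<and> int p ^ (2 * m + 1) = 2 ^ a * t - 1"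
  proof (induction m)
    case 0
    show ?case using odd_l p by (intro exI[of _ "int l"]) simp
  next
    case (Suc m)
    then obtain t where t: "odd t" "int p ^ (2 * m + 1) = 2 ^ a * t - 1" by blast
    define t' where "t' = int p ^ 2 * t - int l * (int p - 1)"
    have "even (2 ^ a * int l)" using a2 by simp
    then have "odd (int p)" using p by simp
    then have "odd t'" using t(1) by (simp add: t'_def)
    moreover have "int p ^ (2 * Suc m + 1) = 2 ^ a * t' - 1"
    proof -
      have square: "int p ^ 2 = 2 ^ a * int l * (int p - 1) + 1"
        by (simp only: p) (simp add: power2_eq_square algebra_simps)
      have "int p ^ (2 * Suc m + 1) = int p ^ 2 * int p ^ (2 * m + 1)"
        by (simp add: power2_eq_square)
      also have "\<dots> = 2 ^ a * (int p ^ 2 * t) - int p ^ 2"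
        by (simp only: t(2)) (simp add: algebra_simps)
      also have "\<dots> = 2 ^ a * (int p ^ 2 * t) - (2 ^ a * int l * (int p - 1) + 1)"
        by (simp only: square)
      finally show ?thesis by (simp add: t'_def algebra_simps)
    qed
    ultimately show ?case by blast
  qed
  then show ?thesis by (simp add: k)
qed

lemma power_odd:
  assumes "odd k"
  obtains t where "odd t" "p ^ k = 1 + 2 * t"
proof -
  obtain t :: int where t: "odd t" "int p ^ k = 2 ^ a * t - 1" using odd_power_plus_1[OF assms] by blast
  define s where "s = 2 ^ (a - 1) * t - 1"
  have a: "a = Suc (a - 1)" "a - 1 > 0" using a2 by auto
  have "int p ^ k = 1 + 2 * s" unfolding t(2) s_def by (subst a(1)) (simp add: algebra_simps)
  moreover have "int p ^ k \<ge> 0" by simp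
  ultimately have "s \<ge> 0" by linarith
  then obtain s' where s': "s = int s'" by (metis nonneg_int_cases)
  have "int (p ^ k) = int (1 + 2 * s')" using \<open>int p ^ k = 1 + 2 * s\<close> s' by simp
  then have "p ^ k = 1 + 2 * s'" by (simp only: of_nat_eq_iff)
  moreover have "odd s" using a(2) by (simp add: s_def)
  ultimately show ?thesis using that[of s'] s' by simp
qed

text \<open>Every squaring adds one factor \<open>2\<close>, since
  \<open>(1 + 2 ^ (s + 1) * t) ^ 2 = 1 + 2 ^ (s + 2) * (t + 2 ^ s * t ^ 2)\<close>; for \<open>r = 1\<close> the factor
  \<open>p ^ k + 1\<close> contributes \<open>2 ^ a\<close>.\<close>

lemma power_even:
  assumes "odd k" "r \<ge> 1"
  obtains t where "odd t" "p ^ (2 ^ r * k) = 1 + 2 ^ (a + r) * t"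
proof -
  have "\<exists>t :: int. odd t \<and> int p ^ (2 ^ r * k) = 1 + 2 ^ (a + r) * t"
    using assms(2)
  proof (induction r rule: dec_induct)
    case base
    obtain t :: int where t: "odd t" "int p ^ k = 2 ^ a * t - 1"
      using odd_power_plus_1[OF assms(1)] by blast
    define s where "s = a - 1"
    have s: "a = Suc s" "s > 0" using a2 by (simp_all add: s_def)
    have "int p ^ (2 ^ 1 * k) = (int p ^ k) ^ 2" by (simp add: mult.commute flip: power_mult)
    also have "\<dots> = (2 * 2 ^ s * t - 1) ^ 2" by (simp add: t(2) s(1))
    also have "\<dots> = 4 * 2 ^ s * (2 ^ s * t * t - t) + 1" by (simp add: power2_eq_square algebra_simps)
    also have "(4 :: int) * 2 ^ s = 2 ^ (a + 1)" by (simp add: s(1))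
    finally show ?case using t(1) s(2) by (intro exI[of _ "2 ^ s * t * t - t"]) simp
  next
    case (step r)
    then obtain t :: int where t: "odd t" "int p ^ (2 ^ r * k) = 1 + 2 ^ (a + r) * t" by blast
    define s where "s = a + r - 1"
    have s: "a + r = Suc s" "s > 0" using a2 by (simp_all add: s_def)
    have "int p ^ (2 ^ Suc r * k) = (int p ^ (2 ^ r * k)) ^ 2"
      by (simp add: mult_ac flip: power_mult)
    also have "\<dots> = (1 + 2 * 2 ^ s * t) ^ 2" by (simp only: t(2) s(1) power_Suc)
    also have "\<dots> = 1 + 4 * 2 ^ s * (t + 2 ^ s * t * t)" by (simp add: power2_eq_square algebra_simps)
    also have "(4 :: int) * 2 ^ s = 2 ^ (a + Suc r)" by (simp add: s(1))
    finally show ?case using t(1) s(2) by (intro exI[of _ "t + 2 ^ s * t * t"]) simp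
  qed
  then obtain t :: int where t: "odd t" "int p ^ (2 ^ r * k) = 1 + 2 ^ (a + r) * t" by blast
  have "t \<ge> 0"
  proof (rule ccontr)
    assume "\<not> t \<ge> 0"
    then have "2 ^ (a + r) * t \<le> - (2 ^ (a + r))"
      using mult_left_mono[of t "- 1" "2 ^ (a + r)"] by simp
    moreover have "(2 :: int) \<le> 2 ^ (a + r)"
      using power_increasing[of 1 "a + r" "2 :: int"] a2 by simp
    moreover have "int p ^ (2 ^ r * k) \<ge> 0" by simp
    ultimately show False using t(2) by linarith
  qed
  then obtain t' where t': "t = int t'" by (metis nonneg_int_cases)
  have "int (p ^ (2 ^ r * k)) = int (1 + 2 ^ (a + r) * t')" using t t' by simp
  then have "p ^ (2 ^ r * k) = 1 + 2 ^ (a + r) * t'" by (simp only: of_nat_eq_iff)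
  then show ?thesis using that[of t'] t t' by simp
qed

end

text \<open>The root of unity \<open>\<zeta>\<close> has order \<open>2 ^ (a + \<alpha>)\<close>, the full power of \<open>2\<close> dividing \<open>p ^ n - 1\<close>.
  The decomposition depends only on the action of the Galois group on \<open>\<zeta>\<close>.\<close>

locale cyclic_extension_with_root = cyclic_extension L \<phi> n \<theta> + two_adic p a l
  for L :: "'k :: field_char_0 alg_closure set" and \<phi> n \<theta> p a l +
  fixes \<alpha> k :: nat and \<zeta> :: "'k alg_closure"
  assumes n_eq: "n = 2 ^ \<alpha> * k" and odd_k: "odd k" and \<alpha>2: "2 \<le> \<alpha>" and \<alpha>a: "\<alpha> \<le> a + 1"
    and \<zeta>_L [simp]: "\<zeta> \<in> L" and \<phi>_\<zeta>: "\<phi> \<zeta> = \<zeta> ^ p"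
    and \<zeta>_half: "\<zeta> ^ 2 ^ (a + \<alpha> - 1) = - 1"
begin

lemmas \<zeta>_half' = \<zeta>_half[unfolded One_nat_def]

lemma \<zeta>_nonzero [simp]: "\<zeta> \<noteq> 0"
  using \<zeta>_half by (auto simp: power_0_left split: if_splits)

lemma \<zeta>_odd: "odd t \<Longrightarrow> \<zeta> ^ (2 ^ (a + \<alpha> - 1) * t) = - 1"
  by (simp add: power_mult \<zeta>_half')

lemma iter_\<zeta>: "(\<phi> ^^ i) \<zeta> = \<zeta> ^ (p ^ i)"
  by (induction i) (simp_all add: \<phi>_power \<phi>_\<zeta> flip: power_mult)

text \<open>The element \<open>c j\<close> generates one fixed field of the chain
  \<open>Fix (n div 2 ^ j) \<subseteq> Fix (n div 2 ^ (j - 1))\<close> over the other; for the last quadratic step,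
  down to the fixed field of \<open>\<phi> ^^ k\<close>, the fourth root of unity \<open>\<iota>\<close> takes over.\<close>

definition c :: "nat \<Rightarrow> 'k alg_closure" where "c j = \<zeta> ^ 2 ^ (j - 1)"

definition \<iota> :: "'k alg_closure" where "\<iota> = \<zeta> ^ 2 ^ (a + \<alpha> - 2)"

lemma c_L [simp]: "c j \<in> L" and c_nonzero [simp]: "c j \<noteq> 0"
  and \<iota>_L [simp]: "\<iota> \<in> L" and \<iota>_nonzero [simp]: "\<iota> \<noteq> 0"
  by (simp_all add: c_def \<iota>_def)

lemma \<iota>_square: "\<iota> ^ 2 = - 1"
proof -
  have "\<iota> ^ 2 = \<zeta> ^ 2 ^ Suc (a + \<alpha> - 2)" by (simp add: \<iota>_def mult.commute flip: power_mult)
  also have "Suc (a + \<alpha> - 2) = a + \<alpha> - 1" using \<alpha>2 by simp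
  finally show ?thesis by (simp add: \<zeta>_half')
qed

lemma iter_c:
  assumes "1 \<le> j" "j \<le> \<alpha> - 1"
  shows "(\<phi> ^^ (2 ^ (\<alpha> - j) * k)) (c j) = - c j"
proof -
  have "\<alpha> - j \<ge> 1" using assms \<alpha>2 by simp
  then obtain t where t: "odd t" "p ^ (2 ^ (\<alpha> - j) * k) = 1 + 2 ^ (a + (\<alpha> - j)) * t"
    using power_even[OF odd_k] by blast
  have "(\<phi> ^^ (2 ^ (\<alpha> - j) * k)) (c j) = \<zeta> ^ ((1 + 2 ^ (a + (\<alpha> - j)) * t) * 2 ^ (j - 1))"
    unfolding c_def iter_power[OF \<zeta>_L] iter_\<zeta> t(2) by (rule power_mult[symmetric])
  also have "(1 + 2 ^ (a + (\<alpha> - j)) * t) * 2 ^ (j - 1) = 2 ^ (j - 1) + 2 ^ (a + (\<alpha> - j) + (j - 1)) * t"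
    by (simp add: power_add algebra_simps)
  also have "a + (\<alpha> - j) + (j - 1) = a + \<alpha> - 1" using assms by simp
  finally show ?thesis using \<zeta>_odd[OF t(1)] by (simp add: power_add c_def)
qed

lemma iter_\<iota>:
  assumes "odd i"
  shows "(\<phi> ^^ i) \<iota> = - \<iota>"
proof -
  obtain t where t: "odd t" "p ^ i = 1 + 2 * t" using power_odd[OF assms] by blast
  have "(\<phi> ^^ i) \<iota> = \<iota> ^ (p ^ i)"
    by (simp add: \<iota>_def iter_power iter_\<zeta> mult.commute flip: power_mult)
  also have "\<dots> = \<iota> * (\<iota> ^ 2) ^ t" by (simp only: t(2) power_add power_mult power_one_right)
  also have "\<dots> = - \<iota>" using t(1) by (simp add: \<iota>_square)
  finally show ?thesis .
qed

lemma dim_Fix_power: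
  assumes "i \<le> \<alpha>"
  shows "ac.dim (Fix (2 ^ i * k)) = 2 ^ i * k"
proof -
  have step: "ac.dim (Fix (2 ^ Suc i * k)) = 2 * ac.dim (Fix (2 ^ i * k))" if "i < \<alpha>" for i
  proof (cases "i = 0")
    case True
    then show ?thesis using dim_Fix_double[of \<iota> k] iter_\<iota>[OF odd_k] by simp
  next
    case False
    then show ?thesis
      using dim_Fix_double[of "c (\<alpha> - i)" "2 ^ i * k"] iter_c[of "\<alpha> - i"] that by (simp add: mult.assoc)
  qed
  have eq: "ac.dim (Fix (2 ^ i * k)) = 2 ^ i * ac.dim (Fix k)" if "i \<le> \<alpha>" for i
    using that by (induction i) (simp_all only: step Suc_le_eq, simp_all)
  have "2 ^ \<alpha> * ac.dim (Fix k) = 2 ^ \<alpha> * k"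
    using eq[of \<alpha>] Fix_n dim_L by (simp add: n_eq)
  then show ?thesis using eq[OF assms] by simp
qed

lemma dim_Fix_2: "ac.dim (Fix 2) = 2"
  using dim_Fix_double[of \<iota> 1] iter_\<iota>[of 1] dim_Fix_1 by simp

definition V :: "nat \<Rightarrow> 'k alg_closure set" where
  "V j = (if j = 1 then Fix k else (*) \<iota> ` Fix k)"

definition E :: "nat \<Rightarrow> 'k alg_closure set" where
  "E j = (*) (c j) ` Fix (2 ^ (\<alpha> - j) * k)"

lemma V_L: "V j \<subseteq> L" and E_L: "E j \<subseteq> L"
  by (auto simp: V_def E_def Fix_def)

lemma subspace_V: "ac.subspace (V j)" and subspace_E: "ac.subspace (E j)"
  by (simp_all add: V_def E_def subspace_Fix subspace_multiple)

lemma dim_V: "ac.dim (V j) = k"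
  using dim_Fix_power[of 0] by (simp add: V_def dim_multiple)

lemma dim_E: "1 \<le> j \<Longrightarrow> j \<le> \<alpha> - 1 \<Longrightarrow> ac.dim (E j) = n div 2 ^ j"
proof -
  assume j: "1 \<le> j" "j \<le> \<alpha> - 1"
  then have "n = 2 ^ (\<alpha> - j) * k * 2 ^ j" by (simp add: n_eq mult_ac flip: power_add)
  then show ?thesis using dim_Fix_power[of "\<alpha> - j"] by (simp add: E_def dim_multiple)
qed

text \<open>Climbing the chain of fixed fields: each quadratic step adds the eigenspace \<open>E j\<close> on which the
  involution acts as \<open>- 1\<close>.\<close>

lemma direct_sum_Fix:
  assumes "1 \<le> i" "i \<le> \<alpha>"
  shows "is_direct_sum (Fix (2 ^ i * k)) ({1..2} <+> {\<alpha> - i + 1..\<alpha> - 1}) (case_sum V E)"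
  using assms
proof (induction i rule: dec_induct)
  case base
  have one: "is_direct_sum (Fix k) {Inl 1} (case_sum V E)"
  proof (rule is_direct_sum_insert[OF is_direct_sum_empty])
    show "bij_betw (\<lambda>(x, y). x + y) ({0} \<times> case_sum V E (Inl 1)) (Fix k)"
      by (auto simp: V_def bij_betw_def inj_on_def image_def)
  qed auto
  have "is_direct_sum (Fix (2 * k)) (insert (Inl 2) {Inl 1}) (case_sum V E)"
    using Fix_double[of \<iota> k] iter_\<iota>[OF odd_k]
    by (intro is_direct_sum_insert[OF one]) (simp_all add: V_def)
  moreover have "insert (Inl 2) {Inl 1} = {1..2 :: nat} <+> ({} :: nat set)"
    by (auto simp: Plus_def le_Suc_eq)
  ultimately show ?case using \<alpha>2 by simp
next
  case (step i)
  define j where "j = \<alpha> - i"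
  have j: "1 \<le> j" "j \<le> \<alpha> - 1" "\<alpha> - j = i" using step by (auto simp: j_def)
  have "is_direct_sum (Fix (2 * (2 ^ i * k))) (insert (Inr j) ({1..2} <+> {\<alpha> - i + 1..\<alpha> - 1})) (case_sum V E)"
  proof (rule is_direct_sum_insert)
    show "is_direct_sum (Fix (2 ^ i * k)) ({1..2} <+> {\<alpha> - i + 1..\<alpha> - 1}) (case_sum V E)"
      using step by simp
    show "bij_betw (\<lambda>(x, y). x + y) (Fix (2 ^ i * k) \<times> case_sum V E (Inr j)) (Fix (2 * (2 ^ i * k)))"
      using Fix_double[of "c j" "2 ^ i * k"] iter_c[OF j(1,2)] by (simp add: E_def j(3))
  qed (auto simp: j_def)
  moreover have "insert (Inr j) ({1..2 :: nat} <+> {\<alpha> - i + 1..\<alpha> - 1}) = {1..2} <+> {\<alpha> - Suc i + 1..\<alpha> - 1}"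
  proof -
    have "{\<alpha> - Suc i + 1..\<alpha> - 1} = insert j {\<alpha> - i + 1..\<alpha> - 1}"
      using step by (auto simp: j_def)
    then show ?thesis by (auto simp: Plus_def)
  qed
  ultimately show ?case by (simp add: mult.assoc)
qed

text \<open>Square roots are determined up to sign, and \<open>- 1\<close> is itself a power of \<open>\<zeta>\<close>.\<close>

lemma roots_of_unity:
  assumes "z ^ 2 ^ j = 1" "j \<le> a + \<alpha>"
  obtains r where "z = \<zeta> ^ r"
proof -
  have "\<exists>r. z = \<zeta> ^ (2 ^ (a + \<alpha> - j) * r)" if "z ^ 2 ^ j = 1" "j \<le> a + \<alpha>" for z j
    using that
  proof (induction j arbitrary: z)
    case 0
    then show ?case by (intro exI[of _ 0]) simp
  next
    case (Suc j)
    have "(z ^ 2) ^ 2 ^ j = 1" using Suc.prems by (simp flip: power_mult)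
    then obtain r where r: "z ^ 2 = \<zeta> ^ (2 ^ (a + \<alpha> - j) * r)" using Suc by (meson Suc_leD)
    define i where "i = a + \<alpha> - Suc j"
    have i: "a + \<alpha> - j = Suc i" "a + \<alpha> - 1 = i + j" using Suc.prems by (auto simp: i_def)
    have "z ^ 2 = (\<zeta> ^ (2 ^ i * r)) ^ 2"
      unfolding r i(1) by (simp add: mult_ac flip: power_mult)
    then consider "z = \<zeta> ^ (2 ^ i * r)" | "z = - (\<zeta> ^ (2 ^ i * r))" by (auto simp: power2_eq_iff)
    then show ?case
    proof cases
      case 1
      then show ?thesis by (auto simp: i_def)
    next
      case 2
      have "\<zeta> ^ 2 ^ (i + j) = - 1" using \<zeta>_half by (simp only: i(2))
      then have "z = \<zeta> ^ (2 ^ i * r) * \<zeta> ^ 2 ^ (i + j)" using 2 by simp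
      also have "\<dots> = \<zeta> ^ (2 ^ i * (r + 2 ^ j))" by (simp add: algebra_simps flip: power_add)
      finally show ?thesis by (auto simp: i_def)
    qed
  qed
  then show ?thesis using assms that by blast
qed

text \<open>If the radical equation had a solution for \<open>b = c j * y\<close>, the norm of \<open>b\<close> to the quadratic
  subfield would be invariant under \<open>\<phi>\<close>. The norm of \<open>y\<close> is a \<open>2 ^ j\<close>-th power \<open>u ^ 2 ^ j\<close>,
  because \<open>y\<close> lies in a subfield of index \<open>2 ^ j\<close>, so extracting roots compares \<open>\<phi> u / u\<close>, whose
  norm to the base is \<open>1\<close>, with a power of the norm \<open>\<eta>\<close> of \<open>\<zeta>\<close>. They differ by a root of
  unity \<open>w\<close> of order dividing \<open>2 ^ j\<close>, hence dividing \<open>p + 1\<close>, which forces \<open>w * \<phi> w = 1\<close>; but the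
  order of \<open>\<zeta>\<close> gives \<open>w * \<phi> w = - 1\<close>.\<close>

lemma E_nondegenerate:
  assumes j: "1 \<le> j" "j \<le> \<alpha> - 1" and b: "b \<in> E j" "b \<noteq> 0"
    and x: "x \<in> L" "b * x = \<phi> b * \<phi> (\<phi> x)"
  shows "x = 0"
proof (rule ccontr)
  assume x0: "x \<noteq> 0"
  obtain y where y: "y \<in> Fix (2 ^ (\<alpha> - j) * k)" "b = c j * y" using b(1) by (auto simp: E_def)
  have yL [simp]: "y \<in> L" and y0: "y \<noteq> 0" and bL: "b \<in> L" using y b E_L[of j] by (auto simp: Fix_def)
  define q where "q = 2 ^ (\<alpha> - j - 1) * k"
  define h where "h = 2 ^ (\<alpha> - 1) * k"
  have "\<alpha> - j = Suc (\<alpha> - j - 1)" using j \<alpha>2 by simp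
  then have "2 ^ (\<alpha> - j) = 2 * (2 :: nat) ^ (\<alpha> - j - 1)" by (metis power_Suc)
  then have "2 ^ (\<alpha> - j) * k = 2 * q" by (simp add: q_def)
  then have y_fix: "(\<phi> ^^ (2 * q)) y = y" using y(1) by (simp add: Fix_def)
  have n_h: "n = 2 * h" using \<alpha>2 by (simp add: n_eq h_def flip: power_Suc)
  have h_q: "h = 2 ^ j * q" using j by (simp add: h_def q_def flip: power_add)
  \<comment> \<open>the relative norm from \<open>L\<close> to the quadratic subfield\<close>
  define NN where "NN z = (\<Prod>t<h. (\<phi> ^^ (2 * t)) z)" for z
  have NN_L [simp]: "NN z \<in> L" if "z \<in> L" for z using that by (simp add: NN_def)
  have NN_mult: "NN (z * w) = NN z * NN w" if "z \<in> L" "w \<in> L" for z w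
    using that by (simp add: NN_def iter_mult prod.distrib)
  have NN_power: "NN (z ^ m) = NN z ^ m" if "z \<in> L" for z m
    using that by (simp add: NN_def iter_power prod_power_distrib)
  have NN_\<phi>: "NN (\<phi> z) = \<phi> (NN z)" if "z \<in> L" for z
    using that by (simp add: NN_def \<phi>_prod funpow_swap1)
  have NN_0: "NN z \<noteq> 0" if "z \<in> L" "z \<noteq> 0" for z using that by (simp add: NN_def)
  have NN_shift: "NN (\<phi> (\<phi> z)) = NN z" if "z \<in> L" "z \<noteq> 0" for z
  proof -
    have "NN (\<phi> (\<phi> z)) = (\<Prod>t<h. (\<phi> ^^ (2 * Suc t)) z)"
      by (simp add: NN_def funpow_swap1)
    also have "\<dots> = NN z"
      unfolding NN_def using that \<phi>_order by (intro prod_shift) (auto simp: n_h)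
    finally show ?thesis .
  qed
  have "NN b * NN x = \<phi> (NN b) * NN x"
  proof -
    have "NN b * NN x = NN (\<phi> b * \<phi> (\<phi> x))" using x bL by (simp flip: NN_mult)
    also have "\<dots> = NN (\<phi> b) * NN (\<phi> (\<phi> x))" using x(1) bL by (intro NN_mult) auto
    finally show ?thesis by (simp only: NN_\<phi>[OF bL] NN_shift[OF x(1) x0])
  qed
  then have fixed: "\<phi> (NN b) = NN b" using NN_0[OF x(1) x0] by simp
  define u where "u = (\<Prod>t<q. (\<phi> ^^ (2 * t)) y)"
  have uL [simp]: "u \<in> L" and u0: "u \<noteq> 0" using y0 by (simp_all add: u_def)
  have u_fix: "\<phi> (\<phi> u) = u"
  proof -
    have "\<phi> (\<phi> u) = (\<Prod>t<q. (\<phi> ^^ (2 * Suc t)) y)"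
      by (simp add: u_def \<phi>_prod funpow_swap1)
    also have "\<dots> = u" unfolding u_def using y0 y_fix by (intro prod_shift) auto
    finally show ?thesis .
  qed
  have NN_y: "NN y = u ^ 2 ^ j"
    unfolding NN_def u_def h_q
  proof (rule prod_periodic)
    fix t
    have "(\<phi> ^^ (2 * (q + t))) y = (\<phi> ^^ (2 * t)) ((\<phi> ^^ (2 * q)) y)"
      by (simp add: iter_iter algebra_simps)
    then show "(\<phi> ^^ (2 * (q + t))) y = (\<phi> ^^ (2 * t)) y" by (simp add: y_fix)
  qed
  define e where "e = (\<Sum>t<h. p ^ (2 * t))"
  define \<eta> where "\<eta> = \<zeta> ^ e"
  have \<eta>L [simp]: "\<eta> \<in> L" and \<eta>0: "\<eta> \<noteq> 0" by (simp_all add: \<eta>_def)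
  have NN_\<zeta>: "NN \<zeta> = \<eta>" by (simp add: NN_def \<eta>_def e_def iter_\<zeta> power_sum)
  have \<phi>_\<eta>: "\<phi> \<eta> = \<eta> ^ p" by (simp add: \<eta>_def \<phi>_power \<phi>_\<zeta> mult.commute flip: power_mult)
  obtain s where s: "p = 1 + 2 * s" using power_odd[of 1] by auto
  have "1 + 2 * ((\<Sum>t<h. p ^ (2 * t)) * (p + 1) * s) = p ^ (2 * h)" for h
  proof (induction h)
    case (Suc h)
    have "1 + 2 * ((\<Sum>t<Suc h. p ^ (2 * t)) * (p + 1) * s) =
        (1 + 2 * ((\<Sum>t<h. p ^ (2 * t)) * (p + 1) * s)) + p ^ (2 * h) * (2 * (p + 1) * s)"
      by (simp add: algebra_simps)
    also have "\<dots> = p ^ (2 * h) * (1 + 2 * (p + 1) * s)" by (simp only: Suc) (simp add: algebra_simps)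
    also have "1 + 2 * (p + 1) * s = p ^ 2" by (simp add: s power2_eq_square algebra_simps)
    finally show ?case by (simp add: power2_eq_square mult_ac)
  qed simp
  then have geometric: "1 + 2 * (e * (p + 1) * s) = p ^ n" by (simp add: e_def n_h)
  obtain t where t: "odd t" "p ^ n = 1 + 2 ^ (a + \<alpha>) * t"
    using power_even[OF odd_k, of \<alpha>] \<alpha>2 unfolding n_eq by auto
  have "a + \<alpha> = Suc (a + \<alpha> - 1)" using \<alpha>2 by simp
  then have "(2 :: nat) ^ (a + \<alpha>) = 2 * 2 ^ (a + \<alpha> - 1)" by (metis power_Suc)
  then have exponent: "e * (p + 1) * s = 2 ^ (a + \<alpha> - 1) * t" using geometric t(2) by simp
  have "\<eta> ^ ((p + 1) * s) = \<zeta> ^ (e * (p + 1) * s)"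
    unfolding \<eta>_def mult.assoc by (rule power_mult[symmetric])
  also have "\<dots> = - 1" unfolding exponent by (rule \<zeta>_odd[OF t(1)])
  finally have \<eta>_half: "\<eta> ^ ((p + 1) * s) = - 1" .
  \<comment> \<open>invariance of the norm makes \<open>w\<close> a root of unity of order dividing \<open>2 ^ j\<close>\<close>
  define w where "w = \<eta> ^ s * (\<phi> u / u)"
  have wL: "w \<in> L" by (simp add: w_def)
  have NN_b: "NN b = \<eta> ^ 2 ^ (j - 1) * u ^ 2 ^ j"
    by (simp add: y(2) NN_mult c_def NN_power NN_\<zeta> NN_y)
  have "\<phi> (NN b) = (\<eta> ^ p) ^ 2 ^ (j - 1) * \<phi> u ^ 2 ^ j"
    by (simp add: NN_b \<phi>_mult \<phi>_power \<phi>_\<eta>)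
  also have "(\<eta> ^ p) ^ 2 ^ (j - 1) = \<eta> ^ 2 ^ (j - 1) * (\<eta> ^ s) ^ 2 ^ j"
  proof -
    have "2 ^ j = 2 * (2 :: nat) ^ (j - 1)" using j(1) by (simp flip: power_Suc)
    then have "p * 2 ^ (j - 1) = 2 ^ (j - 1) + s * 2 ^ j" by (simp add: s algebra_simps)
    then show ?thesis by (simp flip: power_mult power_add)
  qed
  finally have "NN b = \<eta> ^ 2 ^ (j - 1) * ((\<eta> ^ s) ^ 2 ^ j * \<phi> u ^ 2 ^ j)"
    by (simp only: fixed mult.assoc)
  then have "u ^ 2 ^ j = (\<eta> ^ s) ^ 2 ^ j * \<phi> u ^ 2 ^ j" using \<eta>0 unfolding NN_b by simp
  then have "(\<eta> ^ s) ^ 2 ^ j * \<phi> u ^ 2 ^ j = u ^ 2 ^ j" by (rule sym)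
  then have "w ^ 2 ^ j = 1" using u0 by (simp add: w_def power_mult_distrib power_divide)
  moreover have "j \<le> a + \<alpha>" using j by simp
  ultimately obtain r where r: "w = \<zeta> ^ r" by (rule roots_of_unity)
  \<comment> \<open>the two evaluations of \<open>w * \<phi> w\<close> disagree\<close>
  have "\<phi> w = w ^ p" by (simp add: r \<phi>_power \<phi>_\<zeta> mult.commute flip: power_mult)
  then have "w * \<phi> w = w ^ (p + 1)" by simp
  also have "p + 1 = 2 ^ j * (2 ^ (a - j) * l)"
  proof -
    have "j + (a - j) = a" using j \<alpha>a by simp
    then have "(2 :: nat) ^ a = 2 ^ j * 2 ^ (a - j)" by (metis power_add)
    then show ?thesis by (simp only: pa mult.assoc)
  qed
  also have "w ^ \<dots> = 1" by (simp only: power_mult \<open>w ^ 2 ^ j = 1\<close> power_one)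
  finally have "w * \<phi> w = 1" .
  moreover have "w * \<phi> w = \<eta> ^ ((p + 1) * s)"
  proof -
    have "w * \<phi> w = \<eta> ^ s * (\<eta> ^ p) ^ s * ((\<phi> u / u) * (u / \<phi> u))"
      by (simp add: w_def \<phi>_mult \<phi>_power \<phi>_divide \<phi>_\<eta> u_fix)
    also have "\<dots> = \<eta> ^ s * (\<eta> ^ p) ^ s" using u0 by simp
    also have "\<dots> = \<eta> ^ ((p + 1) * s)" by (simp add: algebra_simps flip: power_mult power_add)
    finally show ?thesis .
  qed
  ultimately show False using \<eta>_half by simp
qed

text \<open>Since \<open>k\<close> is odd, \<open>\<phi> b = (\<phi> ^^ (k + 1)) b\<close> with \<open>k + 1\<close> even, so \<open>b / \<phi> b\<close> is a telescoping
  product of quotients of consecutive \<open>\<phi> ^^ 2\<close>-conjugates of \<open>b\<close>.\<close>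

lemma Fix_k_degenerate:
  assumes b: "b \<in> Fix k" "b \<noteq> 0"
  obtains x where "x \<in> L" "x \<noteq> 0" "b * x = \<phi> b * \<phi> (\<phi> x)"
proof -
  have bL [simp]: "b \<in> L" and b_fix: "(\<phi> ^^ k) b = b" using b by (auto simp: Fix_def)
  obtain m where k: "k = 2 * m + 1" using odd_k by (elim oddE)
  define s where "s = Suc m"
  define y where "y = (\<Prod>i<s. (\<phi> ^^ (2 * i)) b)"
  have yL [simp]: "y \<in> L" and y0: "y \<noteq> 0" using b(2) by (simp_all add: y_def)
  have "b * \<phi> (\<phi> y) = (\<phi> ^^ (2 * 0)) b * (\<Prod>i<s. (\<phi> ^^ (2 * Suc i)) b)"
    by (simp add: y_def \<phi>_prod funpow_swap1)
  also have "\<dots> = (\<Prod>i<Suc s. (\<phi> ^^ (2 * i)) b)" by (rule prod.lessThan_Suc_shift[symmetric])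
  also have "\<dots> = y * (\<phi> ^^ (2 * s)) b" by (simp add: y_def)
  also have "2 * s = 1 + k" by (simp add: s_def k)
  also have "(\<phi> ^^ (1 + k)) b = \<phi> b" by (simp add: b_fix)
  finally have eq: "b * \<phi> (\<phi> y) = y * \<phi> b" .
  show ?thesis
  proof (rule that[of "inverse y"])
    show "b * inverse y = \<phi> b * \<phi> (\<phi> (inverse y))"
    proof -
      have "\<phi> (\<phi> (inverse y)) = inverse (\<phi> (\<phi> y))" by (simp add: \<phi>_inverse)
      moreover have "\<phi> (\<phi> y) \<noteq> 0" using y0 by simp
      moreover have "b * inverse Y' = B * inverse Y"
        if "b * Y = Y' * B" "Y \<noteq> 0" "Y' \<noteq> 0" for B Y Y' using that by (simp add: field_simps)
      ultimately show ?thesis using eq y0 by simp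
    qed
  qed (use y0 in auto)
qed

lemma V_degenerate:
  assumes b: "b \<in> V j" "b \<noteq> 0"
  obtains x where "x \<in> L" "x \<noteq> 0" "b * x = \<phi> b * \<phi> (\<phi> x)"
proof (cases "j = 1")
  case True
  then show ?thesis using Fix_k_degenerate[of b] b that by (auto simp: V_def)
next
  case False
  then obtain y where y: "y \<in> Fix k" "b = \<iota> * y" using b by (auto simp: V_def)
  then have "y \<noteq> 0" and yL: "y \<in> L" using b by (auto simp: Fix_def)
  then obtain x where x: "x \<in> L" "x \<noteq> 0" "y * x = \<phi> y * \<phi> (\<phi> x)"
    using Fix_k_degenerate[OF y(1)] by blast
  \<comment> \<open>\<open>\<iota> / \<phi> \<iota> = - 1\<close> is compensated by an element that \<open>\<phi> ^^ 2\<close> negates\<close>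
  define d where "d = \<zeta> ^ 2 ^ (\<alpha> - 2)"
  have dL [simp]: "d \<in> L" and d0: "d \<noteq> 0" by (simp_all add: d_def)
  have "\<phi> (\<phi> d) = - d"
  proof -
    obtain t where t: "odd t" "p ^ (2 ^ 1 * 1) = 1 + 2 ^ (a + 1) * t" using power_even[of 1 1] by auto
    have square: "p ^ 2 = 1 + 2 ^ (a + 1) * t" using t(2) by simp
    have "\<phi> (\<phi> d) = (\<phi> ^^ 2) d" by (simp add: numeral_2_eq_2)
    also have "\<dots> = \<zeta> ^ ((1 + 2 ^ (a + 1) * t) * 2 ^ (\<alpha> - 2))"
      unfolding d_def iter_power[OF \<zeta>_L] iter_\<zeta> square by (rule power_mult[symmetric])
    also have "(1 + 2 ^ (a + 1) * t) * 2 ^ (\<alpha> - 2) = 2 ^ (\<alpha> - 2) + 2 ^ (a + 1 + (\<alpha> - 2)) * t"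
      by (simp add: power_add algebra_simps)
    also have "a + 1 + (\<alpha> - 2) = a + \<alpha> - 1" using \<alpha>2 by simp
    finally show ?thesis using \<zeta>_odd[OF t(1)] by (simp add: power_add d_def)
  qed
  moreover have "\<phi> \<iota> = - \<iota>" using iter_\<iota>[of 1] by simp
  ultimately have "\<phi> b * \<phi> (\<phi> (x * d)) = \<iota> * (\<phi> y * \<phi> (\<phi> x)) * d"
    using x(1) yL by (simp add: y(2) \<phi>_mult)
  then have "b * (x * d) = \<phi> b * \<phi> (\<phi> (x * d))" by (simp add: y(2) flip: x(3))
  then show ?thesis using that[of "x * d"] x d0 by simp
qed

lemma n_gt_2: "n > 2"
proof -
  have "(2 :: nat) ^ 2 \<le> 2 ^ \<alpha>" using \<alpha>2 by (intro power_increasing) auto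
  moreover have "k \<ge> 1" using odd_k by (cases k) auto
  ultimately have "2 ^ 2 * 1 \<le> 2 ^ \<alpha> * k" by (intro mult_le_mono)
  then show ?thesis by (simp add: n_eq)
qed

theorem skew_space_decomposition:
  "\<exists>(V :: nat \<Rightarrow> 'k form set) (E :: nat \<Rightarrow> 'k form set).
     (\<forall>j\<in>{1..2}. form.subspace (V j) \<and> V j \<subseteq> skew_space L (\<sigma> 1)) \<and>
     (\<forall>i\<in>{1..\<alpha> - 1}. form.subspace (E i) \<and> E i \<subseteq> skew_space L (\<sigma> 1)) \<and>
     is_direct_sum (skew_space L (\<sigma> 1)) ({1..2} <+> {1..\<alpha> - 1}) (case_sum V E) \<and>
     (\<forall>i\<in>{1..\<alpha> - 1}. rank_subspace L n (E i) \<and> form.dim (E i) = n div 2 ^ i) \<and>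
     (\<forall>j\<in>{1..2}. rank_subspace L (n - 2) (V j) \<and> form.dim (V j) = k)"
proof (intro exI conjI ballI)
  have space: "skew_space L (\<sigma> 1) = form ` L" by (simp add: skew_space_def form_def)
  let ?V = "\<lambda>j. form ` V j" and ?E = "\<lambda>j. form ` E j"
  fix j
  show "form.subspace (?V j)" "form.subspace (?E j)"
    using form_image(1)[OF n_gt_2] subspace_V subspace_E V_L E_L by blast+
  show "?V j \<subseteq> skew_space L (\<sigma> 1)" "?E j \<subseteq> skew_space L (\<sigma> 1)"
    unfolding space using V_L E_L by blast+
  show "form.dim (?V j) = k"
    using form_image(2)[OF n_gt_2 subspace_V V_L] dim_V by simp
  show "form.dim (?E j) = n div 2 ^ j" if "j \<in> {1..\<alpha> - 1}"
    using form_image(2)[OF n_gt_2 subspace_E E_L] dim_E that by simp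
  show "rank_subspace L (n - 2) (?V j)"
    unfolding rank_subspace_def
  proof (intro conjI ballI impI)
    show "form.subspace (?V j)" by fact
    show "?V j \<subseteq> alt_forms L" using form_alt V_L by blast
    fix f assume "f \<in> ?V j" "f \<noteq> 0"
    then obtain b where b: "b \<in> V j" "f = form b" "b \<noteq> 0" using form_0 by auto
    then obtain x where "x \<in> L" "x \<noteq> 0" "b * x = \<phi> b * \<phi> (\<phi> x)" using V_degenerate by blast
    then show "form_rank L f = n - 2"
      using rank_degenerate[OF _ b(3) _ _ _ dim_Fix_2] b V_L by blast
  qed
  show "rank_subspace L n (?E j)" if j: "j \<in> {1..\<alpha> - 1}"
    unfolding rank_subspace_def
  proof (intro conjI ballI impI)
    show "form.subspace (?E j)" by fact
    show "?E j \<subseteq> alt_forms L" using form_alt E_L by blast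
    fix f assume "f \<in> ?E j" "f \<noteq> 0"
    then obtain b where b: "b \<in> E j" "f = form b" "b \<noteq> 0" using form_0 by auto
    then show "form_rank L f = n"
      using rank_nondegenerate[of b] E_nondegenerate[of j b] E_L j by auto
  qed
next
  have "is_direct_sum L ({1..2} <+> {1..\<alpha> - 1}) (case_sum V E)"
    using direct_sum_Fix[of \<alpha>] \<alpha>2 Fix_n by (simp add: n_eq)
  then have "is_direct_sum (form ` L) ({1..2} <+> {1..\<alpha> - 1}) (\<lambda>i. form ` case_sum V E i)"
    using V_L E_L by (intro is_direct_sum_image form_inj[OF n_gt_2] form_sum) (auto split: sum.splits)
  moreover have "(\<lambda>i. form ` case_sum V E i) = case_sum (\<lambda>j. form ` V j) (\<lambda>j. form ` E j)"
    by (auto simp: fun_eq_iff split: sum.splits)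
  ultimately show "is_direct_sum (skew_space L (\<sigma> 1)) ({1..2} <+> {1..\<alpha> - 1})
      (case_sum (\<lambda>j. form ` V j) (\<lambda>j. form ` E j))"
    by (simp add: skew_space_def form_def)
qed

end

section \<open>The unramified extension of degree n of the p-adic numbers\<close>

text \<open>If \<open>\<eta>\<close> is a primitive \<open>m\<close>-th root of unity and \<open>q\<close> is prime, then a root \<open>\<omega>\<close> of
  \<open>X ^ q - \<eta>\<close> with \<open>\<omega> ^ m \<noteq> 1\<close> is a primitive \<open>q * m\<close>-th one; multiplying by a nontrivial \<open>q\<close>-th root of unity
  repairs a bad choice of \<open>\<omega>\<close>.\<close>

lemma primitive_root_of_unity:
  assumes "m > 0"
  shows "\<exists>\<omega> :: 'a :: {alg_closed_field, field_char_0}. \<forall>j. \<omega> ^ j = 1 \<longleftrightarrow> m dvd j"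
  using assms
proof (induction m rule: less_induct)
  case (less m)
  show ?case
  proof (cases "m = 1")
    case True
    then show ?thesis by (intro exI[of _ 1]) simp
  next
    case False
    then obtain q where q: "prime q" "q dvd m" using prime_factor_nat by blast
    then obtain m' where m: "m = q * m'" by blast
    have q1: "q > 1" using q(1) prime_gt_1_nat by blast
    have m': "m' > 0" "m' < m" using less.prems q1 by (auto simp: m)
    obtain \<eta> :: 'a where \<eta>: "\<And>j. \<eta> ^ j = 1 \<longleftrightarrow> m' dvd j" using less.IH[OF m'(2,1)] by blast
    obtain \<omega>0 where \<omega>0: "\<omega>0 ^ q = \<eta>" using nth_root_exists[of q \<eta>] q1 by auto
    define P where "P = (\<Sum>i<q. monom (1 :: 'a) i)"
    have "coeff P (q - 1) = 1" using q1 by (simp add: P_def coeff_sum)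
    then have "q - 1 \<le> degree P" by (intro le_degree) simp
    then have "degree P > 0" using q1 by linarith
    then obtain \<rho> where \<rho>: "poly P \<rho> = 0" using alg_closed_imp_poly_has_root by blast
    have \<rho>_sum: "(\<Sum>i<q. \<rho> ^ i) = 0" using \<rho> by (simp add: P_def poly_sum poly_monom)
    have \<rho>q: "\<rho> ^ q = 1" using power_diff_1_eq[of \<rho> q] \<rho>_sum by simp
    have \<rho>1: "\<rho> \<noteq> 1" using \<rho>_sum q1 by auto
    have q_dvd: "q dvd j" if "z ^ q = 1" "z \<noteq> 1" "z ^ j = 1" for z :: 'a and j
    proof (rule ccontr)
      assume "\<not> q dvd j"
      then have "coprime j q" using q(1) prime_imp_coprime[of q j] by (simp add: coprime_commute)
      moreover have "j \<noteq> 0" using \<open>\<not> q dvd j\<close> by (metis dvd_0_right)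
      ultimately obtain x y where "j * x = q * y + 1" using bezout_nat[of j q] by auto
      then have "(z ^ j) ^ x = (z ^ q) ^ y * z" by (simp flip: power_mult add: power_add)
      then show False using that by simp
    qed
    obtain \<omega> where \<omega>: "\<omega> ^ q = \<eta>" "\<omega> ^ m' \<noteq> 1"
    proof (cases "\<omega>0 ^ m' = 1")
      case False
      then show ?thesis using that \<omega>0 by blast
    next
      case True
      have "(\<omega>0 * \<rho>) ^ m' \<noteq> 1"
      proof
        assume "(\<omega>0 * \<rho>) ^ m' = 1"
        then have "\<rho> ^ m' = 1" using True by (simp add: power_mult_distrib)
        then have "q dvd m'" using q_dvd \<rho>q \<rho>1 by blast
        then obtain s where s: "m' = q * s" by blast
        then have "\<eta> ^ s = 1" using True \<omega>0 by (simp add: power_mult)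
        then have "m' dvd s" using \<eta> by blast
        then show False using s m' q1 by (auto dest!: dvd_imp_le)
      qed
      then show ?thesis using that[of "\<omega>0 * \<rho>"] \<omega>0 \<rho>q by (simp add: power_mult_distrib)
    qed
    have \<omega>m: "\<omega> ^ m = 1" using \<omega>(1) \<eta>[of m'] by (simp add: m power_mult)
    have "\<omega> ^ j = 1 \<longleftrightarrow> m dvd j" for j
    proof
      assume j: "\<omega> ^ j = 1"
      have "\<eta> ^ j = (\<omega> ^ j) ^ q" by (simp add: \<omega>(1)[symmetric] mult.commute flip: power_mult)
      then have "m' dvd j" using j \<eta> by simp
      then obtain t where t: "j = m' * t" by blast
      have "(\<omega> ^ m') ^ q = 1" using \<omega>m by (simp add: m mult.commute flip: power_mult)
      then have "q dvd t" using q_dvd[of "\<omega> ^ m'" t] \<omega>(2) j by (simp add: t power_mult)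
      then show "m dvd j" by (auto simp: m t)
    qed (auto simp: power_mult \<omega>m)
    then show ?thesis by blast
  qed
qed

theorem theoremD:
  fixes p a l n \<alpha> k :: nat
    and v :: "'k :: field_char_0 \<Rightarrow> real"
  assumes "prime p"
    and "padic_completion p v"
    and "\<not> (\<exists>x :: 'k. x ^ 2 = - 1)"
    and "p + 1 = 2 ^ a * l" and "odd l" and "a \<ge> 1"
    and "n = 2 ^ \<alpha> * k" and "odd k" and "2 \<le> \<alpha>" and "\<alpha> \<le> a + 1"
  shows "\<exists>(L :: 'k alg_closure set) \<sigma> (V :: nat \<Rightarrow> 'k form set) (E :: nat \<Rightarrow> 'k form set).
     finite_galois_extension L \<and> ac.dim L = n \<and>
     \<sigma> \<in> carrier (gal_group L) \<and> carrier (gal_group L) = generate (gal_group L) {\<sigma>} \<and>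
     (\<forall>j\<in>{1..2}. form.subspace (V j) \<and> V j \<subseteq> skew_space L \<sigma>) \<and>
     (\<forall>i\<in>{1..\<alpha> - 1}. form.subspace (E i) \<and> E i \<subseteq> skew_space L \<sigma>) \<and>
     is_direct_sum (skew_space L \<sigma>) ({1..2} <+> {1..\<alpha> - 1}) (case_sum V E) \<and>
     (\<forall>i\<in>{1..\<alpha> - 1}. rank_subspace L n (E i) \<and> form.dim (E i) = n div 2 ^ i) \<and>
     (\<forall>j\<in>{1..2}. rank_subspace L (n - 2) (V j) \<and> form.dim (V j) = k)"
proof -
  have n_pos: "n > 0" using \<open>n = 2 ^ \<alpha> * k\<close> \<open>odd k\<close> by (cases k) auto
  have p1: "p > 1" by (rule prime_gt_1_nat[OF \<open>prime p\<close>])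
  have "p ^ n - 1 > 0" using one_less_power[OF p1 n_pos] by simp
  then obtain \<omega> :: "'k alg_closure" where \<omega>: "\<And>j. \<omega> ^ j = 1 \<longleftrightarrow> p ^ n - 1 dvd j"
    using primitive_root_of_unity by blast
  interpret unramified p v n \<omega>
    by unfold_locales (use assms \<omega> n_pos in auto)
  have half: "\<omega> ^ m = - 1" if "N = 2 * m" for m
  proof -
    have "(\<omega> ^ m) ^ 2 = 1" using that \<omega>_power_N by (simp add: mult.commute flip: power_mult)
    moreover have "\<omega> ^ m \<noteq> 1"
    proof
      assume "\<omega> ^ m = 1"
      then have "N dvd m" using \<omega>_power_eq_1_iff by blast
      then show False using that N_pos by (auto dest!: dvd_imp_le)
    qed
    ultimately show ?thesis by (auto simp: power2_eq_1_iff)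
  qed
  \<comment> \<open>For \<open>a = 1\<close> the Frobenius fixes the primitive fourth roots of unity.\<close>
  have "a \<ge> 2"
  proof (rule ccontr)
    assume "\<not> a \<ge> 2"
    then have "p + 1 = 2 * l" using assms by (cases "a = 1") auto
    then obtain s where s: "p = 1 + 4 * s"
      using \<open>odd l\<close> by (elim oddE) auto
    have "4 dvd p ^ n - 1"
    proof -
      have "[p = 1] (mod 4)" by (simp add: s cong_def)
      then have "[p ^ n = 1 ^ n] (mod 4)" by (rule cong_pow)
      then show ?thesis using p1 by (simp add: cong_altdef_nat)
    qed
    then obtain m where m: "N = 4 * m" unfolding N_def by blast
    define i where "i = \<omega> ^ m"
    have i2: "i ^ 2 = - 1" using half[of "2 * m"] m by (simp add: i_def mult.commute flip: power_mult)
    have "\<phi> i = i ^ p" by (simp add: i_def \<phi>_power mult.commute flip: power_mult)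
    also have "\<dots> = i * ((i ^ 2) ^ 2) ^ s" by (simp add: s power_add flip: power_mult)
    also have "\<dots> = i" by (simp add: i2)
    finally have "i \<in> range to_ac" using fixed_field by (simp add: i_def)
    then obtain x where "i = to_ac x" by blast
    then have "to_ac (x ^ 2) = to_ac (- 1)" using i2 by simp
    then have "x ^ 2 = - 1" by (simp only: to_ac_eq_iff)
    then show False using assms(3) by blast
  qed
  interpret two_adic p a l by unfold_locales (use assms \<open>a \<ge> 2\<close> in auto)
  obtain t where t: "odd t" "p ^ n = 1 + 2 ^ (a + \<alpha>) * t"
    using power_even[OF \<open>odd k\<close>, of \<alpha>] assms by auto
  \<comment> \<open>removing the odd part of the order \<open>p ^ n - 1\<close> of \<open>\<omega>\<close>\<close>
  define \<zeta> where "\<zeta> = \<omega> ^ t"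
  interpret cyclic_extension_with_root L \<phi> n \<omega> p a l \<alpha> k \<zeta>
  proof
    have "a + \<alpha> = Suc (a + \<alpha> - 1)" using \<open>a \<ge> 2\<close> by simp
    then have "(2 :: nat) ^ (a + \<alpha>) = 2 * 2 ^ (a + \<alpha> - 1)" by (metis power_Suc)
    then have "N = 2 * (t * 2 ^ (a + \<alpha> - 1))" using t by (simp add: N_def)
    then show "\<zeta> ^ 2 ^ (a + \<alpha> - 1) = - 1" unfolding \<zeta>_def by (simp only: half flip: power_mult)
    show "\<phi> \<zeta> = \<zeta> ^ p" by (simp add: \<zeta>_def \<phi>_power mult.commute flip: power_mult)
    show "\<zeta> \<in> L" by (simp add: \<zeta>_def)
  qed (use assms in auto)
  show ?thesis
    using finite_galois dim_L \<sigma>_carrier[of 1] gal_group_generated skew_space_decomposition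
    by (intro exI[of _ L] exI[of _ "\<sigma> 1"]) simp
qed

end
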